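(* There exists a constant $c$ such that for every binary string $x\in\{0,1\}^*$, $$\Big|\limsup_{n\to\infty} \mathit{KA}(x\mid n)-\mathit{KA}^{\mathbf{0}'}(x)\Big|\le c.$$
   Context: A semimeasure on the binary tree is a function $a:\{0,1\}^*\to[0,1]$ with $a(\Lambda)\le 1$ (where $\Lambda$ is the empty string) and $a(y)\ge a(y0)+a(y1)$ for all strings $y$. Such $a$ is lower semicomputable if there is a computable total rational-valued function $(y,s)\mapsto a(y,s)$, nondecreasing in $s$, with limit $a(y)$. The a priori complexity $\mathit{KA}(x)$ is $-\log_2 a(x)$ for a maximal (up to a constant factor) lower semicomputable semimeasure $a$ on the binary tree. The conditional version $\mathit{KA}(x\mid n)=-\log_2 a(x\mid n)$, where $a(x\mid n)$ is maximal (up to a constant factor) among functions lower semicomputable in $(x,n)$ such that $x\mapsto a(x\mid n)$ is a semimeasure on the binary tree for every $n$. $\mathbf{0}'$ denotes the halting problem, and $\mathit{KA}^{\mathbf{0}'}$ is the a priori complexity relativized to the oracle $\mathbf{0}'$ (using a maximal semimeasure on the binary tree lower semicomputable relative to $\mathbf{0}'$). *)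

theory Defs
  imports Complex_Main "HOL-Library.Nat_Bijection" "HOL-Library.Countable"
    "HOL-Library.Extended_Real" "HOL-Library.Liminf_Limsup"
begin

text \<open>Partial recursive functions relative to a set \<open>A\<close> of natural numbers, presented as unary
  functions; several arguments are passed through the pairing function \<^const>\<open>prod_encode\<close>.\<close>

datatype code =
    Zero | Succ | Left | Right | Query
  | Tuple code code
  | Comp code code
  | PrimRec code code
  | Search code

primrec run :: "nat set \<Rightarrow> code \<Rightarrow> nat \<Rightarrow> nat option" where
  "run A Zero x = Some 0"
| "run A Succ x = Some (Suc x)"
| "run A Left x = Some (fst (prod_decode x))"
| "run A Right x = Some (snd (prod_decode x))"
| "run A Query x = Some (if x \<in> A then 1 else 0)"
| "run A (Tuple f g) x =
     Option.bind (run A f x) (\<lambda>u. Option.bind (run A g x) (\<lambda>v. Some (prod_encode (u, v))))"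
| "run A (Comp f g) x = Option.bind (run A g x) (run A f)"
| "run A (PrimRec f g) x =
     (case prod_decode x of (y, m) \<Rightarrow>
        rec_nat (run A f y)
          (\<lambda>k r. Option.bind r (\<lambda>v. run A g (prod_encode (y, prod_encode (k, v))))) m)"
| "run A (Search f) x =
     (let found = (\<lambda>m. run A f (prod_encode (x, m)) = Some 0 \<and>
                       (\<forall>k<m. \<exists>v. run A f (prod_encode (x, k)) = Some (Suc v)))
      in if \<exists>m. found m then Some (THE m. found m) else None)"

primrec code_num :: "code \<Rightarrow> nat" where
  "code_num Zero = prod_encode (0, 0)"
| "code_num Succ = prod_encode (1, 0)"
| "code_num Left = prod_encode (2, 0)"
| "code_num Right = prod_encode (3, 0)"
| "code_num Query = prod_encode (4, 0)"
| "code_num (Tuple f g) = prod_encode (5, prod_encode (code_num f, code_num g))"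
| "code_num (Comp f g) = prod_encode (6, prod_encode (code_num f, code_num g))"
| "code_num (PrimRec f g) = prod_encode (7, prod_encode (code_num f, code_num g))"
| "code_num (Search f) = prod_encode (8, code_num f)"

text \<open>With the empty set \<^const>\<open>Query\<close> is constantly \<open>0\<close>, so \<open>run {}\<close> is ordinary
  computability.\<close>

definition halting_problem :: "nat set" where
  "halting_problem = {prod_encode (code_num p, x) | p x. run {} p x \<noteq> None}"

definition string_encode :: "bool list \<Rightarrow> nat" where
  "string_encode x = list_encode (map of_bool x)"

text \<open>Rational outputs are named by integer fractions: \<open>nat_to_rat_surj\<close> decodes a pair
  (numerator, denominator).\<close>

definition computable_rat :: "nat set \<Rightarrow> ('a \<Rightarrow> nat) \<Rightarrow> ('a \<Rightarrow> rat) \<Rightarrow> bool" where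
  "computable_rat A enc q \<longleftrightarrow>
     (\<exists>p. \<forall>x. \<exists>v. run A p (enc x) = Some v \<and> nat_to_rat_surj v = q x)"

definition lower_semicomputable :: "nat set \<Rightarrow> ('a \<Rightarrow> nat) \<Rightarrow> ('a \<Rightarrow> real) \<Rightarrow> bool" where
  "lower_semicomputable A enc f \<longleftrightarrow>
     (\<exists>q :: 'a \<times> nat \<Rightarrow> rat.
        computable_rat A (\<lambda>(x, s). prod_encode (enc x, s)) q \<and>
        (\<forall>x. mono (\<lambda>s. q (x, s))) \<and>
        (\<forall>x. (\<lambda>s. of_rat (q (x, s))) \<longlonglongrightarrow> f x))"

definition semimeasure :: "(bool list \<Rightarrow> real) \<Rightarrow> bool" where
  "semimeasure a \<longleftrightarrow>
     (\<forall>y. 0 \<le> a y \<and> a y \<le> 1) \<and> (\<forall>y. a (y @ [False]) + a (y @ [True]) \<le> a y)"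

definition lsc_semimeasure :: "nat set \<Rightarrow> (bool list \<Rightarrow> real) \<Rightarrow> bool" where
  "lsc_semimeasure A a \<longleftrightarrow> semimeasure a \<and> lower_semicomputable A string_encode a"

definition maximal_lsc_semimeasure :: "nat set \<Rightarrow> (bool list \<Rightarrow> real) \<Rightarrow> bool" where
  "maximal_lsc_semimeasure A a \<longleftrightarrow>
     lsc_semimeasure A a \<and>
     (\<forall>b. lsc_semimeasure A b \<longrightarrow> (\<exists>C>0. \<forall>x. b x \<le> C * a x))"

definition cond_lsc_semimeasure :: "nat set \<Rightarrow> (bool list \<Rightarrow> nat \<Rightarrow> real) \<Rightarrow> bool" where
  "cond_lsc_semimeasure A a \<longleftrightarrow>
     (\<forall>n. semimeasure (\<lambda>x. a x n)) \<and>
     lower_semicomputable A (\<lambda>(x, n). prod_encode (string_encode x, n)) (\<lambda>(x, n). a x n)"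

definition maximal_cond_lsc_semimeasure :: "nat set \<Rightarrow> (bool list \<Rightarrow> nat \<Rightarrow> real) \<Rightarrow> bool" where
  "maximal_cond_lsc_semimeasure A a \<longleftrightarrow>
     cond_lsc_semimeasure A a \<and>
     (\<forall>b. cond_lsc_semimeasure A b \<longrightarrow> (\<exists>C>0. \<forall>x n. b x n \<le> C * a x n))"

definition neg_log2 :: "real \<Rightarrow> ereal" where
  "neg_log2 p = (if p > 0 then ereal (- log 2 p) else \<infinity>)"

definition KA :: "(bool list \<Rightarrow> real) \<Rightarrow> bool list \<Rightarrow> ereal" where
  "KA a x = neg_log2 (a x)"

definition KA_cond :: "(bool list \<Rightarrow> nat \<Rightarrow> real) \<Rightarrow> bool list \<Rightarrow> nat \<Rightarrow> ereal" where
  "KA_cond a x n = neg_log2 (a x n)"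

end

theory Submission imports Defs begin

text \<open>
  Both inequalities compare semimeasures up to a constant factor, with \<open>limsup KA(x | n)\<close> turned into
  \<open>liminf a(x | n)\<close>.

  \<^item> A semimeasure \<open>m\<close> that is lower semicomputable in the halting problem is a double limit of
    computable approximations: at time \<open>n\<close> replace the oracle by what has been enumerated so far. The
    semimeasure with condition \<open>n\<close> follows the stages of the approximation to \<open>m\<close> as long as the
    computed weights have sum at most \<open>1\<close> on every antichain. Every fixed stage is computed correctly for
    all large \<open>n\<close>, so the \<open>liminf\<close> is at least \<open>m\<close>.

  \<^item> Conversely \<open>liminf a(x | n)\<close> is not obviously lower semicomputable in the halting problem (its
    definition is \<open>\<Sigma>\<^sub>3\<close>). Instead one grants requests to raise a weight \<open>g(x)\<close> to a power of \<open>1/2\<close>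
    greedily: at stage \<open>s\<close> the request is granted if for all \<open>n \<ge> s\<close> the least semimeasure above
    \<open>max a(\<cdot> | n) g\<close> still has root value at most \<open>1\<close>. This is a \<open>\<Pi>\<^sub>1\<close> question, and a request with
    \<open>2^-j \<le> a(x | n)\<close> for all large \<open>n\<close> changes nothing in these maxima, hence is granted eventually.
\<close>

section \<open>Computable functions\<close>

definition pi1 :: "nat \<Rightarrow> nat" where "pi1 z = fst (prod_decode z)"
definition pi2 :: "nat \<Rightarrow> nat" where "pi2 z = snd (prod_decode z)"

lemma pi1_prod_encode [simp]: "pi1 (prod_encode (a, b)) = a"
  and pi2_prod_encode [simp]: "pi2 (prod_encode (a, b)) = b"
  and prod_encode_pi [simp]: "prod_encode (pi1 z, pi2 z) = z"
  by (simp_all add: pi1_def pi2_def)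

lemma pi1_le: "pi1 z \<le> z" and pi2_le: "pi2 z \<le> z"
  using le_prod_encode_1[of "pi1 z" "pi2 z"] le_prod_encode_2[of "pi2 z" "pi1 z"] by simp_all

definition computable :: "nat set \<Rightarrow> (nat \<Rightarrow> nat) \<Rightarrow> bool" where
  "computable A f \<longleftrightarrow> (\<exists>p. \<forall>x. run A p x = Some (f x))"

definition decidable :: "nat set \<Rightarrow> (nat \<Rightarrow> bool) \<Rightarrow> bool" where
  "decidable A P \<longleftrightarrow> computable A (\<lambda>x. of_bool (P x))"

lemma computable_comp:
  assumes "computable A F" "computable A f"
  shows "computable A (\<lambda>x. F (f x))"
proof -
  obtain p q where "\<And>x. run A p x = Some (F x)" "\<And>x. run A q x = Some (f x)"
    using assms by (auto simp: computable_def)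
  then have "\<forall>x. run A (Comp p q) x = Some (F (f x))" by simp
  then show ?thesis unfolding computable_def by blast
qed

lemma decidable_comp: "decidable A P \<Longrightarrow> computable A f \<Longrightarrow> decidable A (\<lambda>x. P (f x))"
  unfolding decidable_def by (rule computable_comp)

lemma computable_pair:
  assumes "computable A f" "computable A g"
  shows "computable A (\<lambda>x. prod_encode (f x, g x))"
proof -
  obtain p q where "\<And>x. run A p x = Some (f x)" "\<And>x. run A q x = Some (g x)"
    using assms by (auto simp: computable_def)
  then have "\<forall>x. run A (Tuple p q) x = Some (prod_encode (f x, g x))" by simp
  then show ?thesis unfolding computable_def by blast
qed

lemma computable_pi1: "computable A f \<Longrightarrow> computable A (\<lambda>x. pi1 (f x))"
  by (rule computable_comp) (auto simp: computable_def pi1_def intro: exI[of _ Left])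

lemma computable_pi2: "computable A f \<Longrightarrow> computable A (\<lambda>x. pi2 (f x))"
  by (rule computable_comp) (auto simp: computable_def pi2_def intro: exI[of _ Right])

lemma computable_Suc: "computable A f \<Longrightarrow> computable A (\<lambda>x. Suc (f x))"
  by (rule computable_comp) (auto simp: computable_def intro: exI[of _ Succ])

text \<open>No atomic program is the identity; pairing the two projections of \<open>x\<close>
  restores \<open>x\<close>.\<close>

lemma computable_id: "computable A (\<lambda>x. x)"
  using computable_pair[of A pi1 pi2]
  by (simp add: computable_def pi1_def pi2_def) (metis run.simps(3,4))

lemma computable_const: "computable A (\<lambda>x. c)"
proof (induction c)
  case 0
  show ?case by (auto simp: computable_def intro: exI[of _ Zero])
qed (rule computable_Suc)

lemma decidable_const: "decidable A (\<lambda>x. c)"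
  unfolding decidable_def by (rule computable_const)

text \<open>The whole argument \<open>x\<close> is handed to \<open>PrimRec\<close> as its
  parameter, so base, step and number of steps may all depend on it. The premise on \<open>g\<close>
  packs parameter, counter and accumulator into one number.\<close>

lemma computable_rec_nat:
  assumes "computable A b" "computable A m"
    and "computable A (\<lambda>z. g (pi1 z) (pi1 (pi2 z)) (pi2 (pi2 z)))"
  shows "computable A (\<lambda>x. rec_nat (b x) (g x) (m x))"
proof -
  obtain p q where p: "\<And>x. run A p x = Some (b x)"
    and q: "\<And>z. run A q z = Some (g (pi1 z) (pi1 (pi2 z)) (pi2 (pi2 z)))"
    using assms by (auto simp: computable_def)
  have "run A (PrimRec p q) z = Some (rec_nat (b (pi1 z)) (g (pi1 z)) (pi2 z))" for z
  proof -
    have "rec_nat (run A p y)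
        (\<lambda>k r. Option.bind r (\<lambda>v. run A q (prod_encode (y, prod_encode (k, v))))) k
      = Some (rec_nat (b y) (g y) k)" for y k
      by (induction k) (auto simp: p q)
    then show ?thesis by (simp add: pi1_def pi2_def split: prod.split)
  qed
  then have "computable A (\<lambda>z. rec_nat (b (pi1 z)) (g (pi1 z)) (pi2 z))"
    unfolding computable_def by blast
  from computable_comp[OF this computable_pair[OF computable_id assms(2)]] show ?thesis by simp
qed

lemmas computable_basic = computable_pair computable_pi1 computable_pi2 computable_Suc
  computable_id computable_const decidable_const

lemma computable_comp2:
  assumes "computable A (\<lambda>z. F (pi1 z) (pi2 z))" "computable A f" "computable A g"
  shows "computable A (\<lambda>x. F (f x) (g x))"
  using computable_comp[OF assms(1) computable_pair[OF assms(2,3)]] by simp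

lemma computable_comp3:
  assumes "computable A (\<lambda>z. F (pi1 z) (pi1 (pi2 z)) (pi2 (pi2 z)))"
    and "computable A f" "computable A g" "computable A h"
  shows "computable A (\<lambda>x. F (f x) (g x) (h x))"
  using computable_comp[OF assms(1) computable_pair[OF assms(2) computable_pair[OF assms(3,4)]]]
  by simp

section \<open>Arithmetic, decidable predicates and case distinction\<close>

lemma computable_add:
  assumes "computable A f" "computable A g"
  shows "computable A (\<lambda>x. f x + g x)"
proof -
  have "rec_nat a (\<lambda>k r. Suc r) b = a + b" for a b by (induction b) auto
  moreover have "computable A (\<lambda>x. rec_nat (f x) (\<lambda>k r. Suc r) (g x))"
    by (rule computable_rec_nat assms computable_basic)+
  ultimately show ?thesis by simp
qed

lemma computable_diff:
  assumes "computable A f" "computable A g"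
  shows "computable A (\<lambda>x. f x - g x)"
proof -
  have pre: "rec_nat 0 (\<lambda>k r. k) b = b - 1" for b by (induction b) auto
  have "computable A (\<lambda>x. rec_nat 0 (\<lambda>k r. k) x)"
    by (rule computable_rec_nat computable_basic)+
  then have pred: "computable A (\<lambda>x. x - 1)" by (simp add: pre)
  have "rec_nat a (\<lambda>k r. r - 1) b = a - b" for a b by (induction b) auto
  moreover have "computable A (\<lambda>x. rec_nat (f x) (\<lambda>k r. r - 1) (g x))"
    by (rule computable_rec_nat assms computable_basic computable_comp[OF pred])+
  ultimately show ?thesis by simp
qed

lemma computable_mult:
  assumes "computable A f" "computable A g"
  shows "computable A (\<lambda>x. f x * g x)"
proof -
  have "rec_nat 0 (\<lambda>k r. r + a) b = a * b" for a b :: nat by (induction b) auto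
  moreover have "computable A (\<lambda>x. rec_nat 0 (\<lambda>k r. r + f x) (g x))"
    by (rule computable_rec_nat computable_basic computable_add computable_comp[OF assms(1)] assms(2))+
  ultimately show ?thesis by simp
qed

lemma computable_power:
  assumes "computable A f" "computable A g"
  shows "computable A (\<lambda>x. f x ^ g x)"
proof -
  have "rec_nat 1 (\<lambda>k r. r * a) b = a ^ b" for a b :: nat by (induction b) auto
  moreover have "computable A (\<lambda>x. rec_nat 1 (\<lambda>k r. r * f x) (g x))"
    by (rule computable_rec_nat computable_basic computable_mult computable_comp[OF assms(1)] assms(2))+
  ultimately show ?thesis by simp
qed

lemma decidable_le:
  assumes "computable A f" "computable A g"
  shows "decidable A (\<lambda>x. f x \<le> g x)"
proof -
  have "computable A (\<lambda>x. 1 - (f x - g x))"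
    by (intro computable_basic computable_diff assms)
  moreover have "1 - (a - b) = (of_bool (a \<le> b) :: nat)" for a b :: nat by auto
  ultimately show ?thesis by (simp add: decidable_def)
qed

lemma decidable_not: "decidable A P \<Longrightarrow> decidable A (\<lambda>x. \<not> P x)"
proof -
  assume "decidable A P"
  then have "computable A (\<lambda>x. 1 - of_bool (P x))"
    unfolding decidable_def by (intro computable_basic computable_diff)
  moreover have "1 - of_bool b = (of_bool (\<not> b) :: nat)" for b by auto
  ultimately show ?thesis by (simp add: decidable_def)
qed

lemma decidable_conj: "decidable A P \<Longrightarrow> decidable A Q \<Longrightarrow> decidable A (\<lambda>x. P x \<and> Q x)"
  unfolding decidable_def of_bool_conj by (rule computable_mult)

lemma decidable_disj: "decidable A P \<Longrightarrow> decidable A Q \<Longrightarrow> decidable A (\<lambda>x. P x \<or> Q x)"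
  using decidable_not[OF decidable_conj[OF decidable_not[of A P] decidable_not[of A Q]]] by simp

lemma decidable_imp: "decidable A P \<Longrightarrow> decidable A Q \<Longrightarrow> decidable A (\<lambda>x. P x \<longrightarrow> Q x)"
  unfolding imp_conv_disj by (intro decidable_disj decidable_not)

lemma decidable_less: "computable A f \<Longrightarrow> computable A g \<Longrightarrow> decidable A (\<lambda>x. f x < g x)"
  using decidable_not[OF decidable_le[of A g f]] by (simp add: not_le)

lemma decidable_eq: "computable A f \<Longrightarrow> computable A g \<Longrightarrow> decidable A (\<lambda>x. f x = g x)"
  using decidable_conj[OF decidable_le[of A f g] decidable_le[of A g f]] by (simp add: eq_iff)

lemma decidable_iff: "decidable A P \<Longrightarrow> decidable A Q \<Longrightarrow> decidable A (\<lambda>x. P x \<longleftrightarrow> Q x)"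
  unfolding iff_conv_conj_imp by (intro decidable_conj decidable_imp)

lemma computable_if:
  assumes "decidable A P" "computable A f" "computable A g"
  shows "computable A (\<lambda>x. if P x then f x else g x)"
proof -
  have "computable A (\<lambda>x. of_bool (P x) * f x + (1 - of_bool (P x)) * g x)"
    by (intro computable_add computable_mult computable_diff computable_const assms
        assms(1)[unfolded decidable_def])
  moreover have "of_bool b * u + (1 - of_bool b) * v = (if b then u else v)" for b and u v :: nat
    by simp
  ultimately show ?thesis by simp
qed

lemma computable_max:
  "computable A f \<Longrightarrow> computable A g \<Longrightarrow> computable A (\<lambda>x. max (f x) (g x))"
  unfolding max_def by (intro computable_if decidable_le)

lemma computable_sum:
  assumes "computable A (\<lambda>z. F (pi1 z) (pi2 z))" "computable A m"
  shows "computable A (\<lambda>x. \<Sum>k<m x. F x k)"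
proof -
  have "rec_nat 0 (\<lambda>k r. r + F x k) m = (\<Sum>k<m. F x k)" for x m by (induction m) auto
  moreover have "computable A (\<lambda>x. rec_nat 0 (\<lambda>k r. r + F x k) (m x))"
    using computable_comp[OF assms(1), of "\<lambda>z. prod_encode (pi1 z, pi1 (pi2 z))"]
    by (intro computable_rec_nat computable_basic computable_add assms(2))
       (simp add: computable_basic)
  ultimately show ?thesis by simp
qed

section \<open>Bounded maxima, bounded quantifiers and division\<close>

text \<open>On truth values this is bounded existence; later it serves as the running maximum of
  dyadic numerators.\<close>

primrec bmax :: "(nat \<Rightarrow> nat) \<Rightarrow> nat \<Rightarrow> nat" where
  "bmax F 0 = 0"
| "bmax F (Suc k) = max (bmax F k) (F k)"

lemma bmax_le_iff: "bmax F m \<le> c \<longleftrightarrow> (\<forall>k<m. F k \<le> c)"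
  by (induction m) (auto simp: less_Suc_eq)

lemma bmax_ge: "k < m \<Longrightarrow> F k \<le> bmax F m"
  using bmax_le_iff[of F m "bmax F m"] by simp

lemma bmax_mult: "bmax F m * c = bmax (\<lambda>k. F k * c) m"
  by (induction m) (auto simp: nat_mult_max_left)

lemma bmax_in: "bmax F m = 0 \<or> (\<exists>k<m. bmax F m = F k)"
  by (induction m) (auto simp: max_def less_Suc_eq)

lemma computable_bmax:
  assumes "computable A (\<lambda>z. F (pi1 z) (pi2 z))" "computable A m"
  shows "computable A (\<lambda>x. bmax (F x) (m x))"
proof -
  have "rec_nat 0 (\<lambda>k r. max r (F x k)) m = bmax (F x) m" for x m by (induction m) auto
  moreover have "computable A (\<lambda>x. rec_nat 0 (\<lambda>k r. max r (F x k)) (m x))"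
    using computable_comp[OF assms(1), of "\<lambda>z. prod_encode (pi1 z, pi1 (pi2 z))"]
    by (intro computable_rec_nat computable_basic computable_max assms(2))
       (simp add: computable_basic)
  ultimately show ?thesis by simp
qed

lemma decidable_bex:
  assumes "decidable A (\<lambda>z. P (pi1 z) (pi2 z))" "computable A m"
  shows "decidable A (\<lambda>x. \<exists>k<m x. P x k)"
proof -
  have "computable A (\<lambda>x. bmax (\<lambda>k. of_bool (P x k)) (m x))"
    using assms unfolding decidable_def by (intro computable_bmax)
  moreover have "bmax (\<lambda>k. of_bool (P x k)) m = of_bool (\<exists>k<m. P x k)" for x m
    by (induction m) (auto simp: less_Suc_eq)
  ultimately show ?thesis by (simp add: decidable_def)
qed

lemma decidable_ball:
  assumes "decidable A (\<lambda>z. P (pi1 z) (pi2 z))" "computable A m"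
  shows "decidable A (\<lambda>x. \<forall>k<m x. P x k)"
  using decidable_not[OF decidable_bex[OF decidable_not[OF assms(1)] assms(2)]] by simp

lemma computable_div:
  assumes "computable A f" "computable A g"
  shows "computable A (\<lambda>x. f x div g x)"
proof -
  \<comment> \<open>\<open>a div b\<close> is the largest \<open>k\<close> with
    \<open>k * b \<le> a\<close>; the guard on \<open>b\<close> reproduces
    \<open>a div 0 = 0\<close>.\<close>
  have "bmax (\<lambda>k. if k * b \<le> a \<and> b \<noteq> 0 then k else 0) (Suc a) = a div b" for a b
  proof (cases "b = 0")
    case False
    show ?thesis
    proof (rule antisym)
      show "bmax (\<lambda>k. if k * b \<le> a \<and> b \<noteq> 0 then k else 0) (Suc a) \<le> a div b"
        using False by (auto simp: bmax_le_iff less_eq_div_iff_mult_less_eq)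
      have "a div b < Suc a" by (simp add: le_imp_less_Suc)
      from bmax_ge[OF this, of "\<lambda>k. if k * b \<le> a \<and> b \<noteq> 0 then k else 0"]
      show "a div b \<le> bmax (\<lambda>k. if k * b \<le> a \<and> b \<noteq> 0 then k else 0) (Suc a)"
        using False by simp
    qed
  next
    case True
    then show ?thesis using bmax_le_iff[of "\<lambda>k. 0" "Suc a" 0] by simp
  qed
  moreover have "computable A (\<lambda>x. bmax (\<lambda>k. if k * g x \<le> f x \<and> g x \<noteq> 0 then k else 0) (Suc (f x)))"
    by (intro computable_bmax computable_if decidable_conj decidable_le decidable_not decidable_eq
        computable_mult computable_basic computable_comp[OF assms(1)] computable_comp[OF assms(2)] assms)
  ultimately show ?thesis by simp
qed

lemma decidable_even:
  assumes "computable A f"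
  shows "decidable A (\<lambda>x. even (f x))"
proof -
  have "decidable A (\<lambda>x. f x = 2 * (f x div 2))"
    by (intro decidable_eq computable_mult computable_div computable_basic assms)
  moreover have "n = 2 * (n div 2) \<longleftrightarrow> even n" for n :: nat by presburger
  ultimately show ?thesis by simp
qed

section \<open>Finite sets coded by binary digits\<close>

lemma decidable_set_decode:
  assumes "computable A f" "computable A g"
  shows "decidable A (\<lambda>x. f x \<in> set_decode (g x))"
  unfolding set_decode_def mem_Collect_eq
  by (intro decidable_not decidable_even computable_div computable_power computable_basic assms)

lemma set_decode_imp_power_le: "i \<in> set_decode w \<Longrightarrow> 2 ^ i \<le> w"
  unfolding set_decode_def by (metis div_less even_zero linorder_not_le mem_Collect_eq)

lemma set_decode_less: "i \<in> set_decode w \<Longrightarrow> i < w"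
  using set_decode_imp_power_le less_exp order_less_le_trans by blast

lemma set_encode_less: "W \<subseteq> {..<s} \<Longrightarrow> set_encode W < 2 ^ s"
proof -
  assume "W \<subseteq> {..<s}"
  then have "set_encode W \<le> (\<Sum>i<s. 2 ^ i)"
    unfolding set_encode_def by (intro sum_mono2) auto
  also have "\<dots> < 2 ^ s"
    using sum_power2[of s] by (simp add: atLeast0LessThan)
  finally show ?thesis .
qed

text \<open>Elements of a coded set lie below its code, so this is a bounded quantifier.\<close>

lemma decidable_ex_set_decode:
  assumes "decidable A (\<lambda>z. P (pi1 z) (pi2 z))" "computable A g"
  shows "decidable A (\<lambda>x. \<exists>k\<in>set_decode (g x). P x k)"
proof -
  have "decidable A (\<lambda>x. \<exists>k<g x. k \<in> set_decode (g x) \<and> P x k)"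
    by (intro decidable_bex decidable_conj decidable_set_decode computable_basic assms
        computable_comp[OF assms(2)])
  moreover have "(\<exists>k<w. k \<in> set_decode w \<and> Q k) \<longleftrightarrow> (\<exists>k\<in>set_decode w. Q k)" for w Q
    using set_decode_less by blast
  ultimately show ?thesis by simp
qed

lemma decidable_all_set_decode:
  assumes "decidable A (\<lambda>z. P (pi1 z) (pi2 z))" "computable A g"
  shows "decidable A (\<lambda>x. \<forall>k\<in>set_decode (g x). P x k)"
  using decidable_not[OF decidable_ex_set_decode[OF decidable_not[OF assms(1)] assms(2)]] by simp

lemma computable_sum_set_decode:
  assumes "computable A (\<lambda>z. F (pi1 z) (pi2 z))" "computable A g"
  shows "computable A (\<lambda>x. \<Sum>k\<in>set_decode (g x). F x k)"
proof -
  have "computable A (\<lambda>x. \<Sum>k<g x. if k \<in> set_decode (g x) then F x k else 0)"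
    by (intro computable_sum computable_if decidable_set_decode computable_basic assms
        computable_comp[OF assms(2)])
  moreover have "(\<Sum>k<w. if k \<in> set_decode w then G k else 0) = (\<Sum>k\<in>set_decode w. G k)"
    for w and G :: "nat \<Rightarrow> nat"
    by (subst sum.inter_restrict[symmetric]) (auto intro!: sum.cong dest: set_decode_less)
  ultimately show ?thesis by simp
qed

lemma computable_funpow:
  assumes "computable A F" "computable A b" "computable A m"
  shows "computable A (\<lambda>x. (F ^^ m x) (b x))"
proof -
  have "rec_nat b (\<lambda>k r. F r) m = (F ^^ m) b" for b m by (induction m) auto
  moreover have "computable A (\<lambda>x. rec_nat (b x) (\<lambda>k r. F r) (m x))"
    by (intro computable_rec_nat computable_basic computable_comp[OF assms(1)] assms)
  ultimately show ?thesis by simp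
qed

lemmas decidable_intros = decidable_conj decidable_disj decidable_not decidable_imp decidable_iff
  decidable_le decidable_less decidable_eq decidable_even decidable_set_decode
  decidable_ex_set_decode decidable_bex decidable_ball

lemmas computable_intros = computable_basic decidable_intros computable_add computable_diff
  computable_mult computable_power computable_div computable_max computable_if computable_sum
  computable_bmax

section \<open>Unbounded search\<close>

declare run.simps(9) [simp del]

text \<open>Two different results would clash at the smaller one, where \<open>f\<close> would be
  both zero and positive; hence the description behind \<open>Search\<close> is unambiguous.\<close>

lemma run_Search_eq_Some_iff:
  "run A (Search f) x = Some m \<longleftrightarrow>
     run A f (prod_encode (x, m)) = Some 0 \<and>
     (\<forall>k<m. \<exists>v. run A f (prod_encode (x, k)) = Some (Suc v))"
proof -
  define found where "found m \<longleftrightarrow> run A f (prod_encode (x, m)) = Some 0 \<and>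
     (\<forall>k<m. \<exists>v. run A f (prod_encode (x, k)) = Some (Suc v))" for m
  have run: "run A (Search f) x = (if \<exists>m. found m then Some (THE m. found m) else None)"
    by (simp add: run.simps(9) Let_def found_def)
  have "\<not> found m'" if "found m" "m < m'" for m m'
    using that unfolding found_def by fastforce
  then have "m = m'" if "found m" "found m'" for m m'
    using that by (metis linorder_neqE_nat)
  then have "(THE m. found m) = m" if "found m" for m
    using that by blast
  then have "run A (Search f) x = Some m \<longleftrightarrow> found m"
    unfolding run by auto
  then show ?thesis by (simp add: found_def)
qed

lemma run_Search_total:
  assumes "\<And>m. run A f (prod_encode (x, m)) = Some (F m)"
  shows "run A (Search f) x \<noteq> None \<longleftrightarrow> (\<exists>m. F m = 0)"
proof
  assume "run A (Search f) x \<noteq> None"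
  then obtain m where "run A (Search f) x = Some m" by blast
  then show "\<exists>m. F m = 0" unfolding run_Search_eq_Some_iff assms by auto
next
  assume ex: "\<exists>m. F m = 0"
  define m where "m = (LEAST m. F m = 0)"
  have "F m = 0" unfolding m_def using ex by (rule LeastI_ex)
  moreover have "F k \<noteq> 0" if "k < m" for k
    using that not_less_Least unfolding m_def by blast
  ultimately have "run A (Search f) x = Some m"
    unfolding run_Search_eq_Some_iff assms using not0_implies_Suc by simp
  then show "run A (Search f) x \<noteq> None" by simp
qed

section \<open>Enumerating the halting problem\<close>

text \<open>
  A finite set of triples \<open>(e, x, y)\<close>, read as ``program \<open>e\<close> maps \<open>x\<close> to \<open>y\<close>'', each of which follows
  from others in one evaluation step, certifies all of them: the steps decrease the program or the
  recursion argument, so circular justifications are impossible. This makes halting a \<open>\<Sigma>\<^sub>1\<close> property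
  without an interpreter.
\<close>

definition triple :: "nat \<Rightarrow> nat \<Rightarrow> nat \<Rightarrow> nat" where
  "triple e x y = prod_encode (e, prod_encode (x, y))"

text \<open>One case per tag of \<open>code_num\<close>; the oracle is empty, so tag
  \<open>4\<close> yields \<open>0\<close>. The bounds by \<open>w\<close> make the formula
  decidable and lose nothing, since the output in a triple of \<open>set_decode w\<close> is below
  \<open>w\<close>.\<close>

definition justified :: "nat \<Rightarrow> nat \<Rightarrow> nat \<Rightarrow> nat \<Rightarrow> bool" where
  "justified w e x y \<longleftrightarrow>
     pi1 e = 0 \<and> y = 0 \<or>
     pi1 e = 1 \<and> y = Suc x \<or>
     pi1 e = 2 \<and> y = pi1 x \<or>
     pi1 e = 3 \<and> y = pi2 x \<or>
     pi1 e = 4 \<and> y = 0 \<or>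
     pi1 e = 5 \<and> triple (pi1 (pi2 e)) x (pi1 y) \<in> set_decode w
            \<and> triple (pi2 (pi2 e)) x (pi2 y) \<in> set_decode w \<or>
     pi1 e = 6 \<and> (\<exists>u<w. triple (pi2 (pi2 e)) x u \<in> set_decode w
            \<and> triple (pi1 (pi2 e)) u y \<in> set_decode w) \<or>
     pi1 e = 7 \<and> pi2 x = 0 \<and> triple (pi1 (pi2 e)) (pi1 x) y \<in> set_decode w \<or>
     pi1 e = 7 \<and> pi2 x \<noteq> 0 \<and> (\<exists>v<w. triple e (prod_encode (pi1 x, pi2 x - 1)) v \<in> set_decode w
            \<and> triple (pi2 (pi2 e)) (prod_encode (pi1 x, prod_encode (pi2 x - 1, v))) y
                \<in> set_decode w) \<or>
     pi1 e = 8 \<and> triple (pi2 e) (prod_encode (x, y)) 0 \<in> set_decode w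
            \<and> (\<forall>k<y. \<exists>v<w. triple (pi2 e) (prod_encode (x, k)) (Suc v) \<in> set_decode w)"

definition derivation :: "nat \<Rightarrow> bool" where
  "derivation w \<longleftrightarrow> (\<forall>z<w. z \<in> set_decode w \<longrightarrow> justified w (pi1 z) (pi1 (pi2 z)) (pi2 (pi2 z)))"

lemma derivationD: "derivation w \<Longrightarrow> triple e x y \<in> set_decode w \<Longrightarrow> justified w e x y"
  using set_decode_less[of "triple e x y" w] unfolding derivation_def triple_def by fastforce

lemma derivation_sound:
  assumes "derivation w"
  shows "triple (code_num p) x y \<in> set_decode w \<Longrightarrow> run {} p x = Some y"
proof (induction p arbitrary: x y)
  case (Tuple f g)
  from derivationD[OF assms Tuple.prems]
  show ?case using Tuple.IH[of x] by (auto simp: justified_def)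
next
  case (Comp f g)
  from derivationD[OF assms Comp.prems]
  show ?case using Comp.IH by (fastforce simp: justified_def)
next
  case (PrimRec f g)
  \<comment> \<open>A recursion step appeals to the same program at a smaller argument, hence an
    inner induction on that argument.\<close>
  have "triple (code_num (PrimRec f g)) (prod_encode (a, m)) y \<in> set_decode w \<Longrightarrow>
    run {} (PrimRec f g) (prod_encode (a, m)) = Some y" for a m y
  proof (induction m arbitrary: y)
    case 0
    from derivationD[OF assms this] show ?case using PrimRec.IH(1) by (auto simp: justified_def)
  next
    case (Suc m)
    from derivationD[OF assms Suc.prems] obtain v
      where "triple (code_num (PrimRec f g)) (prod_encode (a, m)) v \<in> set_decode w"
        and "triple (code_num g) (prod_encode (a, prod_encode (m, v))) y \<in> set_decode w"
      by (auto simp: justified_def)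
    then show ?case using Suc.IH PrimRec.IH(2) by fastforce
  qed
  from this[of "pi1 x" "pi2 x"] show ?case using PrimRec.prems by simp
next
  case (Search f)
  from derivationD[OF assms Search.prems]
  have "triple (code_num f) (prod_encode (x, y)) 0 \<in> set_decode w"
    and "\<forall>k<y. \<exists>v<w. triple (code_num f) (prod_encode (x, k)) (Suc v) \<in> set_decode w"
    by (auto simp: justified_def)
  then show ?case unfolding run_Search_eq_Some_iff using Search.IH by blast
qed (auto dest!: derivationD[OF assms] simp: justified_def pi1_def pi2_def)

text \<open>Membership in the coded set occurs only positively, and the bounds by the code grow with
  the set.\<close>

lemma justified_mono:
  assumes "set_decode w \<subseteq> set_decode w'" "justified w e x y"
  shows "justified w' e x y"
proof -
  have "w \<le> w'" using assms(1) by (rule subset_decode_imp_le)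
  then show ?thesis using assms unfolding justified_def
    by (smt (verit, best) order_less_le_trans subsetD)
qed

lemma derivation_Union:
  assumes "finite I" "\<And>i. i \<in> I \<Longrightarrow> derivation (f i)"
  shows "\<exists>w. derivation w \<and> set_decode w = (\<Union>i\<in>I. set_decode (f i))"
proof -
  define w where "w = set_encode (\<Union>i\<in>I. set_decode (f i))"
  have w: "set_decode w = (\<Union>i\<in>I. set_decode (f i))"
    using assms(1) by (simp add: w_def)
  have "derivation w" unfolding derivation_def
  proof (intro allI impI)
    fix z assume "z \<in> set_decode w"
    then obtain i where i: "i \<in> I" "z \<in> set_decode (f i)" using w by auto
    then have "justified (f i) (pi1 z) (pi1 (pi2 z)) (pi2 (pi2 z))"
      using assms(2) set_decode_less[OF i(2)] by (simp add: derivation_def)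
    then show "justified w (pi1 z) (pi1 (pi2 z)) (pi2 (pi2 z))"
      using w i(1) by (intro justified_mono[of "f i" w]) auto
  qed
  then show ?thesis using w by blast
qed

definition provable :: "nat \<Rightarrow> nat \<Rightarrow> nat \<Rightarrow> bool" where
  "provable e x y \<longleftrightarrow> (\<exists>w. derivation w \<and> triple e x y \<in> set_decode w)"

text \<open>An inference needs all its premises in one certificate; finitely many derivations are
  merged into their union.\<close>

lemma provable_common:
  assumes "finite I" "\<And>i. i \<in> I \<Longrightarrow> provable (e i) (x i) (y i)"
  obtains w where "derivation w" "\<And>i. i \<in> I \<Longrightarrow> triple (e i) (x i) (y i) \<in> set_decode w"
proof -
  obtain f where f: "\<And>i. i \<in> I \<Longrightarrow> derivation (f i) \<and> triple (e i) (x i) (y i) \<in> set_decode (f i)"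
    using assms(2) unfolding provable_def by metis
  then obtain w where "derivation w" "set_decode w = (\<Union>i\<in>I. set_decode (f i))"
    using derivation_Union[OF assms(1), of f] by blast
  then show ?thesis using f that by blast
qed

lemma provable_common2:
  assumes "provable e x y" "provable e' x' y'"
  obtains w where "derivation w" "triple e x y \<in> set_decode w" "triple e' x' y' \<in> set_decode w"
  using provable_common[of UNIV "\<lambda>b. if b then e else e'" "\<lambda>b. if b then x else x'"
      "\<lambda>b. if b then y else y'"] assms
  by (smt (verit) UNIV_I finite)

text \<open>The new triple may rest on all of \<open>w\<close>, and by monotonicity adding it
  invalidates nothing.\<close>

lemma provableI:
  assumes "derivation w" "justified w e x y"
  shows "provable e x y"
proof -
  define w' where "w' = set_encode (insert (triple e x y) (set_decode w))"
  have w': "set_decode w' = insert (triple e x y) (set_decode w)" by (simp add: w'_def)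
  have mono: "justified w e x y \<Longrightarrow> justified w' e x y" for e x y
    by (rule justified_mono[of w]) (auto simp: w')
  have "derivation w'" unfolding derivation_def
  proof (intro allI impI)
    fix z assume "z \<in> set_decode w'"
    then consider "z = triple e x y" | "z \<in> set_decode w" using w' by auto
    then show "justified w' (pi1 z) (pi1 (pi2 z)) (pi2 (pi2 z))"
      using assms set_decode_less[of z w]
      by cases (auto intro!: mono simp: derivation_def triple_def)
  qed
  then show ?thesis using w' by (auto simp: provable_def)
qed

lemma triple_less: "triple e x y \<in> set_decode w \<Longrightarrow> y < w"
  using set_decode_less[of "triple e x y" w] le_prod_encode_2[of "prod_encode (x, y)" e]
    le_prod_encode_2[of y x] by (simp add: triple_def)

lemma provable_complete: "run {} p x = Some y \<Longrightarrow> provable (code_num p) x y"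
proof (induction p arbitrary: x y)
  case (Tuple f g)
  then obtain u v where "run {} f x = Some u" "run {} g x = Some v" and y: "y = prod_encode (u, v)"
    by (auto simp: bind_eq_Some_conv)
  then have "provable (code_num f) x u" "provable (code_num g) x v" using Tuple.IH by auto
  then obtain w where "derivation w" "triple (code_num f) x u \<in> set_decode w"
    "triple (code_num g) x v \<in> set_decode w"
    by (rule provable_common2)
  then show ?case by (intro provableI[of w]) (auto simp: justified_def y)
next
  case (Comp f g)
  then obtain u where "run {} g x = Some u" "run {} f u = Some y"
    by (auto simp: bind_eq_Some_conv)
  then have "provable (code_num g) x u" "provable (code_num f) u y" using Comp.IH by auto
  then obtain w where "derivation w" "triple (code_num g) x u \<in> set_decode w"
    "triple (code_num f) u y \<in> set_decode w"
    by (rule provable_common2)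
  then show ?case
    by (intro provableI[of w]) (auto simp: justified_def intro: triple_less)
next
  case (PrimRec f g)
  have "run {} (PrimRec f g) (prod_encode (a, m)) = Some y \<Longrightarrow>
    provable (code_num (PrimRec f g)) (prod_encode (a, m)) y" for a m y
  proof (induction m arbitrary: y)
    case 0
    then have "provable (code_num f) a y" using PrimRec.IH(1) by simp
    then obtain w where "derivation w" "triple (code_num f) a y \<in> set_decode w"
      unfolding provable_def by blast
    then show ?case by (intro provableI[of w]) (auto simp: justified_def)
  next
    case (Suc m)
    then obtain v where v: "run {} (PrimRec f g) (prod_encode (a, m)) = Some v"
      "run {} g (prod_encode (a, prod_encode (m, v))) = Some y"
      by (auto simp: bind_eq_Some_conv)
    obtain w where "derivation w"
      "triple (code_num (PrimRec f g)) (prod_encode (a, m)) v \<in> set_decode w"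
      "triple (code_num g) (prod_encode (a, prod_encode (m, v))) y \<in> set_decode w"
      by (rule provable_common2[OF Suc.IH[OF v(1)] PrimRec.IH(2)[OF v(2)]])
    then show ?case
      by (intro provableI[of w]) (auto simp: justified_def intro: triple_less)
  qed
  from this[of "pi1 x" "pi2 x"] show ?case using PrimRec.prems by simp
next
  case (Search f)
  then have 0: "run {} f (prod_encode (x, y)) = Some 0"
    and "\<forall>k<y. \<exists>v. run {} f (prod_encode (x, k)) = Some (Suc v)"
    unfolding run_Search_eq_Some_iff by auto
  then obtain v where v: "\<And>k. k < y \<Longrightarrow> run {} f (prod_encode (x, k)) = Some (Suc (v k))"
    by metis
  \<comment> \<open>\<open>v'\<close> is \<open>0\<close> at \<open>y\<close> and positive before
    it, so one appeal to \<open>provable_common\<close> collects all premises of the search.\<close>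
  define v' where "v' k = (if k = y then 0 else Suc (v k))" for k
  have "provable (code_num f) (prod_encode (x, k)) (v' k)" if "k \<in> {..y}" for k
    using that Search.IH 0 v unfolding v'_def by auto
  then obtain w where w: "derivation w"
    "\<And>k. k \<in> {..y} \<Longrightarrow> triple (code_num f) (prod_encode (x, k)) (v' k) \<in> set_decode w"
    using provable_common[of "{..y}" "\<lambda>_. code_num f" "\<lambda>k. prod_encode (x, k)" v'] by blast
  have "triple (code_num f) (prod_encode (x, k)) (Suc (v k)) \<in> set_decode w" if "k < y" for k
    using w(2)[of k] that by (simp add: v'_def)
  moreover from this have "v k < w" if "k < y" for k using triple_less that Suc_lessD by blast
  moreover have "triple (code_num f) (prod_encode (x, y)) 0 \<in> set_decode w"
    using w(2)[of y] by (simp add: v'_def)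
  ultimately show ?case
    by (intro provableI[OF w(1)]) (auto simp: justified_def)
\<comment> \<open>Atomic programs need no premises, so the empty derivation, coded by
  \<open>0\<close>, suffices.\<close>
qed (auto intro!: provableI[of 0] simp: justified_def derivation_def pi1_def pi2_def)

lemma provable_iff_run: "provable (code_num p) x y \<longleftrightarrow> run {} p x = Some y"
  using provable_complete derivation_sound by (auto simp: provable_def)

text \<open>
  A derivation for a \<^const>\<open>PrimRec\<close> with recursion argument \<open>0\<close> never looks at the step program, so
  that \<open>e\<close> is a program number at all has to be certified separately.
\<close>

definition code_set :: "nat \<Rightarrow> bool" where
  "code_set v \<longleftrightarrow> (\<forall>e<v. e \<in> set_decode v \<longrightarrow>
     pi1 e \<le> 4 \<and> pi2 e = 0 \<or>
     5 \<le> pi1 e \<and> pi1 e \<le> 7 \<and> pi1 (pi2 e) \<in> set_decode v \<and> pi2 (pi2 e) \<in> set_decode v \<or>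
     pi1 e = 8 \<and> pi2 e \<in> set_decode v)"

text \<open>Strict descent from a composite program number to its parts, whose tags are all nonzero;
  this drives the induction on numbers below.\<close>

lemma pi2_less: "pi1 e \<noteq> 0 \<Longrightarrow> pi2 e < e"
proof -
  assume "pi1 e \<noteq> 0"
  then have "pi2 e < prod_encode (pi1 e, pi2 e)"
    by (cases "pi1 e") (auto simp: prod_encode_def)
  then show ?thesis by simp
qed

text \<open>Forwards, the program numbers up to \<open>e\<close> form a code set, because parts of a
  program have no larger number. Backwards, strong induction on \<open>e\<close> rebuilds the
  program from its parts.\<close>

lemma code_num_range_iff: "e \<in> range code_num \<longleftrightarrow> (\<exists>v. code_set v \<and> e \<in> set_decode v)"
proof
  define v where "v = set_encode {c. c \<le> e \<and> c \<in> range code_num}"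
  have v: "set_decode v = {c. c \<le> e \<and> c \<in> range code_num}" by (simp add: v_def)
  assume "e \<in> range code_num"
  moreover have "code_set v" unfolding code_set_def
  proof (intro allI impI)
    fix c assume "c \<in> set_decode v"
    then obtain p where p: "c = code_num p" and c: "c \<le> e" using v by auto
    have "pi2 c \<le> e" "pi1 (pi2 c) \<le> e" "pi2 (pi2 c) \<le> e"
      using c pi1_le pi2_le le_trans by meson+
    then show "pi1 c \<le> 4 \<and> pi2 c = 0 \<or>
     5 \<le> pi1 c \<and> pi1 c \<le> 7 \<and> pi1 (pi2 c) \<in> set_decode v \<and> pi2 (pi2 c) \<in> set_decode v \<or>
     pi1 c = 8 \<and> pi2 c \<in> set_decode v"
      unfolding v p by (cases p) auto
  qed
  ultimately show "\<exists>v. code_set v \<and> e \<in> set_decode v" using v by blast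
next
  assume "\<exists>v. code_set v \<and> e \<in> set_decode v"
  then obtain v where v: "code_set v" and "e \<in> set_decode v" by blast
  then show "e \<in> range code_num"
  proof (induction e rule: less_induct)
    case (less e)
    have e: "prod_encode (pi1 e, prod_encode (pi1 (pi2 e), pi2 (pi2 e))) = e" by simp
    have "e < v" using less.prems(2) by (rule set_decode_less)
    then consider (0) "pi1 e \<le> 4" "pi2 e = 0"
      | (5) "5 \<le> pi1 e" "pi1 e \<le> 7" "pi1 (pi2 e) \<in> set_decode v" "pi2 (pi2 e) \<in> set_decode v"
      | (8) "pi1 e = 8" "pi2 e \<in> set_decode v"
      using v[unfolded code_set_def, rule_format, of e] less.prems(2) by argo
    then show ?case
    proof cases
      case 0
      then consider "pi1 e = 0" | "pi1 e = 1" | "pi1 e = 2" | "pi1 e = 3" | "pi1 e = 4" by linarith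
      then have "e \<in> {code_num Zero, code_num Succ, code_num Left, code_num Right, code_num Query}"
        by cases (use 0 prod_encode_pi[of e] in auto)
      then show ?thesis by blast
    next
      case 5
      have "pi1 (pi2 e) < e" "pi2 (pi2 e) < e"
        using 5 pi2_less[of e] pi1_le[of "pi2 e"] pi2_le[of "pi2 e"] by linarith+
      then obtain p q where "pi1 (pi2 e) = code_num p" "pi2 (pi2 e) = code_num q"
        using less.IH 5 v by blast
      moreover consider "pi1 e = 5" | "pi1 e = 6" | "pi1 e = 7" using 5 by linarith
      ultimately have "e \<in> {code_num (Tuple p q), code_num (Comp p q), code_num (PrimRec p q)}"
        using e by (metis code_num.simps(6,7,8) insertCI)
      then show ?thesis by blast
    next
      case 8
      then obtain p where "pi2 e = code_num p" using less.IH[of "pi2 e"] pi2_less[of e] v by auto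
      then have "e = code_num (Search p)" using 8 prod_encode_pi[of e] by simp
      then show ?thesis by blast
    qed
  qed
qed

text \<open>Stage \<open>n\<close> of an enumeration of the halting problem: both certificates have
  codes below \<open>n\<close>, which makes the stage decidable and increasing in
  \<open>n\<close>.\<close>

definition halts_by :: "nat \<Rightarrow> nat \<Rightarrow> bool" where
  "halts_by n z \<longleftrightarrow>
     (\<exists>v<n. code_set v \<and> pi1 z \<in> set_decode v) \<and>
     (\<exists>w<n. derivation w \<and> (\<exists>y<w. triple (pi1 z) (pi2 z) y \<in> set_decode w))"

lemma halting_problem_iff: "z \<in> halting_problem \<longleftrightarrow> (\<exists>n. halts_by n z)"
proof -
  have "z \<in> halting_problem \<longleftrightarrow> (\<exists>p. pi1 z = code_num p \<and> run {} p (pi2 z) \<noteq> None)"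
  proof
    assume "\<exists>p. pi1 z = code_num p \<and> run {} p (pi2 z) \<noteq> None"
    then obtain p where "z = prod_encode (code_num p, pi2 z)" "run {} p (pi2 z) \<noteq> None"
      by (metis prod_encode_pi)
    then show "z \<in> halting_problem" unfolding halting_problem_def by blast
  qed (auto simp: halting_problem_def)
  also have "\<dots> \<longleftrightarrow> pi1 z \<in> range code_num \<and> (\<exists>y. provable (pi1 z) (pi2 z) y)"
    using provable_iff_run by auto
  also have "\<dots> \<longleftrightarrow> (\<exists>v. code_set v \<and> pi1 z \<in> set_decode v) \<and>
     (\<exists>w. derivation w \<and> (\<exists>y<w. triple (pi1 z) (pi2 z) y \<in> set_decode w))"
    unfolding code_num_range_iff provable_def using triple_less by blast
  also have "\<dots> \<longleftrightarrow> (\<exists>n. halts_by n z)"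
    unfolding halts_by_def by (metis less_max_iff_disj lessI)
  finally show ?thesis .
qed

lemma halts_by_mono: "halts_by n z \<Longrightarrow> n \<le> n' \<Longrightarrow> halts_by n' z"
  unfolding halts_by_def using order_less_le_trans by blast

lemma eventually_halts_by: "\<forall>\<^sub>F n in sequentially. halts_by n z \<longleftrightarrow> z \<in> halting_problem"
proof (cases "z \<in> halting_problem")
  case True
  then obtain n where "halts_by n z" using halting_problem_iff by blast
  then show ?thesis using True halts_by_mono eventually_sequentially by auto
next
  case False
  then show ?thesis using halting_problem_iff by auto
qed

lemma decidable_derivation: "decidable A derivation"
  unfolding derivation_def[abs_def] justified_def triple_def
  by (intro computable_intros)

lemma decidable_code_set: "decidable A code_set"
  unfolding code_set_def[abs_def] by (intro computable_intros)

lemma decidable_halts_by: "decidable A (\<lambda>x. halts_by (pi2 x) (pi1 x))"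
  unfolding halts_by_def triple_def
  by (intro computable_intros decidable_comp[OF decidable_derivation]
      decidable_comp[OF decidable_code_set])

section \<open>Limit computability\<close>

text \<open>The limit lemma, by induction on the program: oracle queries are answered from stage
  \<open>n\<close> of the enumeration, and a halting computation uses only finitely many
  intermediate values, each eventually correct. Nothing is claimed where the program diverges, but
  \<open>f\<close> has to be total there as well.\<close>

lemma limit_lemma_run:
  "\<exists>f. computable {} f \<and> (\<forall>x y. run halting_problem p x = Some y \<longrightarrow>
     (\<forall>\<^sub>F n in sequentially. f (prod_encode (x, n)) = y))"
proof (induction p)
  case Zero
  show ?case by (rule exI[of _ "\<lambda>z. 0"]) (simp add: computable_basic)
next
  case Succ
  show ?case by (rule exI[of _ "\<lambda>z. Suc (pi1 z)"]) (simp add: computable_basic)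
next
  case Left
  show ?case by (rule exI[of _ "\<lambda>z. pi1 (pi1 z)"]) (simp add: computable_basic, simp add: pi1_def)
next
  case Right
  show ?case by (rule exI[of _ "\<lambda>z. pi2 (pi1 z)"]) (simp add: computable_basic, simp add: pi2_def)
next
  case Query
  have "\<forall>\<^sub>F n in sequentially.
      of_bool (halts_by (pi2 (prod_encode (x, n))) (pi1 (prod_encode (x, n)))) = y"
    if "run halting_problem Query x = Some y" for x y :: nat
    using eventually_halts_by[of x] by eventually_elim (use that in auto)
  then show ?case
    by (intro exI[of _ "\<lambda>z. of_bool (halts_by (pi2 z) (pi1 z))"])
      (use decidable_halts_by[of "{}"] in \<open>simp add: decidable_def\<close>)
next
  case (Tuple p q)
  then obtain f g where f: "computable {} f" "\<And>x y. run halting_problem p x = Some y \<Longrightarrow>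
      \<forall>\<^sub>F n in sequentially. f (prod_encode (x, n)) = y"
    and g: "computable {} g" "\<And>x y. run halting_problem q x = Some y \<Longrightarrow>
      \<forall>\<^sub>F n in sequentially. g (prod_encode (x, n)) = y"
    by blast
  define h where "h z = prod_encode (f z, g z)" for z
  have "computable {} h" unfolding h_def by (intro computable_pair f g)
  moreover have "\<forall>\<^sub>F n in sequentially. h (prod_encode (x, n)) = y"
    if run: "run halting_problem (Tuple p q) x = Some y" for x y
  proof -
    obtain u v where "run halting_problem p x = Some u" "run halting_problem q x = Some v"
      and y: "y = prod_encode (u, v)" using run by (auto simp: bind_eq_Some_conv)
    from f(2)[OF this(1)] g(2)[OF this(2)] show ?thesis
      by eventually_elim (simp add: h_def y)
  qed
  ultimately show ?case by blast
next
  case (Comp p q)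
  then obtain f g where f: "computable {} f" "\<And>x y. run halting_problem p x = Some y \<Longrightarrow>
      \<forall>\<^sub>F n in sequentially. f (prod_encode (x, n)) = y"
    and g: "computable {} g" "\<And>x y. run halting_problem q x = Some y \<Longrightarrow>
      \<forall>\<^sub>F n in sequentially. g (prod_encode (x, n)) = y"
    by blast
  define h where "h z = f (prod_encode (g z, pi2 z))" for z
  have "computable {} h" unfolding h_def
    by (intro computable_comp[OF f(1)] computable_basic g)
  moreover have "\<forall>\<^sub>F n in sequentially. h (prod_encode (x, n)) = y"
    if run: "run halting_problem (Comp p q) x = Some y" for x y
  proof -
    obtain u where "run halting_problem q x = Some u" "run halting_problem p u = Some y"
      using run by (auto simp: bind_eq_Some_conv)
    from g(2)[OF this(1)] f(2)[OF this(2)] show ?thesis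
      by eventually_elim (simp add: h_def)
  qed
  ultimately show ?case by blast
next
  case (PrimRec p q)
  then obtain f g where f: "computable {} f" "\<And>x y. run halting_problem p x = Some y \<Longrightarrow>
      \<forall>\<^sub>F n in sequentially. f (prod_encode (x, n)) = y"
    and g: "computable {} g" "\<And>x y. run halting_problem q x = Some y \<Longrightarrow>
      \<forall>\<^sub>F n in sequentially. g (prod_encode (x, n)) = y"
    by blast
  define h where "h z = rec_nat (f (prod_encode (pi1 (pi1 z), pi2 z)))
    (\<lambda>k r. g (prod_encode (prod_encode (pi1 (pi1 z), prod_encode (k, r)), pi2 z))) (pi2 (pi1 z))" for z
  have "computable {} h" unfolding h_def
    by (intro computable_rec_nat computable_comp[OF f(1)] computable_comp[OF g(1)] computable_basic)
  moreover have "\<forall>\<^sub>F n in sequentially. h (prod_encode (x, n)) = y"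
    if run: "run halting_problem (PrimRec p q) x = Some y" for x y
  proof -
    have "\<forall>\<^sub>F n in sequentially. h (prod_encode (prod_encode (a, m), n)) = y"
      if "run halting_problem (PrimRec p q) (prod_encode (a, m)) = Some y" for a m y
      using that
    proof (induction m arbitrary: y)
      case 0
      then have "run halting_problem p a = Some y" by simp
      from f(2)[OF this] show ?case by eventually_elim (simp add: h_def)
    next
      case (Suc m)
      then obtain v where v: "run halting_problem (PrimRec p q) (prod_encode (a, m)) = Some v"
        "run halting_problem q (prod_encode (a, prod_encode (m, v))) = Some y"
        by (auto simp: bind_eq_Some_conv)
      from Suc.IH[OF v(1)] g(2)[OF v(2)] show ?case
        by eventually_elim (simp add: h_def)
    qed
    from this[of "pi1 x" "pi2 x"] run show ?thesis by simp
  qed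
  ultimately show ?case by blast
next
  case (Search p)
  then obtain f where f: "computable {} f" "\<And>x y. run halting_problem p x = Some y \<Longrightarrow>
      \<forall>\<^sub>F n in sequentially. f (prod_encode (x, n)) = y"
    by blast
  \<comment> \<open>The sum counts the candidates below \<open>n\<close> up to which no zero has been seen, so it equals the
    least zero if there is one below \<open>n\<close>.\<close>
  define h :: "nat \<Rightarrow> nat" where "h z = (\<Sum>k<pi2 z. of_bool
    (\<forall>m<Suc k. f (prod_encode (prod_encode (pi1 z, m), pi2 z)) \<noteq> 0))" for z
  have "decidable {} (\<lambda>y. \<forall>m<Suc (pi2 y).
      f (prod_encode (prod_encode (pi1 (pi1 y), m), pi2 (pi1 y))) \<noteq> 0)"
    by (intro computable_intros computable_comp[OF f(1)])
  then have "computable {} h" unfolding h_def decidable_def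
    by (intro computable_sum computable_basic)
  moreover have "\<forall>\<^sub>F n in sequentially. h (prod_encode (x, n)) = y"
    if "run halting_problem (Search p) x = Some y" for x y
  proof -
    have *: "run halting_problem p (prod_encode (x, y)) = Some 0"
      "\<forall>k<y. \<exists>v. run halting_problem p (prod_encode (x, k)) = Some (Suc v)"
      using that unfolding run_Search_eq_Some_iff by auto
    have "\<forall>\<^sub>F n in sequentially. f (prod_encode (prod_encode (x, k), n)) \<noteq> 0" if "k < y" for k
    proof -
      obtain v where "run halting_problem p (prod_encode (x, k)) = Some (Suc v)"
        using * \<open>k < y\<close> by blast
      from f(2)[OF this] show ?thesis by eventually_elim simp
    qed
    then have "\<forall>\<^sub>F n in sequentially. \<forall>k\<in>{..<y}. f (prod_encode (prod_encode (x, k), n)) \<noteq> 0"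
      by (intro eventually_ball_finite) auto
    with f(2)[OF *(1)] eventually_ge_at_top[of y] show ?thesis
    proof eventually_elim
      case (elim n)
      then have "(\<forall>m<Suc k. f (prod_encode (prod_encode (x, m), n)) \<noteq> 0) \<longleftrightarrow> k < y" for k
        by (metis lessThan_iff less_Suc_eq_le not_less order_le_less_trans)
      then have "h (prod_encode (x, n)) = (\<Sum>k<n. of_bool (k < y))" by (simp add: h_def)
      also have "\<dots> = card ({..<n} \<inter> {k. k < y})" by (simp add: sum_of_bool_eq)
      also have "{..<n} \<inter> {k. k < y} = {..<y}" using elim by auto
      finally show ?case by simp
    qed
  qed
  ultimately show ?case by blast
qed

lemma limit_lemma:
  assumes "computable halting_problem f"
  obtains g where "computable {} g"
    "\<And>x. \<forall>\<^sub>F n in sequentially. g (prod_encode (x, n)) = f x"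
  using assms limit_lemma_run unfolding computable_def by metis

text \<open>A search for \<open>m\<close> halts exactly if a witness exists, so the question is a
  single query about the search program.\<close>

lemma decidable_halting_ex:
  assumes "decidable {} (\<lambda>z. R (pi1 z) (pi2 z))"
  shows "decidable halting_problem (\<lambda>x. \<exists>m. R x m)"
proof -
  obtain p where p: "\<And>z. run {} p z = Some (of_bool (\<not> R (pi1 z) (pi2 z)))"
    using decidable_not[OF assms] unfolding decidable_def computable_def by blast
  have "run {} (Search p) x \<noteq> None \<longleftrightarrow> (\<exists>m. R x m)" for x
    by (subst run_Search_total[of _ _ _ "\<lambda>m. of_bool (\<not> R x m)"]) (simp_all add: p)
  then have "prod_encode (code_num (Search p), x) \<in> halting_problem \<longleftrightarrow> (\<exists>m. R x m)" for x
    unfolding halting_problem_def using provable_iff_run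
    by (smt (verit) mem_Collect_eq option.exhaust prod.inject prod_encode_eq)
  moreover have "computable halting_problem (\<lambda>z. of_bool (z \<in> halting_problem))"
    unfolding computable_def by (rule exI[of _ Query]) simp
  then have "computable halting_problem
      (\<lambda>x. of_bool (prod_encode (code_num (Search p), x) \<in> halting_problem))"
    by (rule computable_comp) (intro computable_basic)
  ultimately show ?thesis unfolding decidable_def by simp
qed

section \<open>The binary tree\<close>

text \<open>Heap numbering: the root is \<open>0\<close> and the sons of \<open>i\<close> are \<open>2 * i + 1\<close> and \<open>2 * i + 2\<close>.\<close>

definition node :: "bool list \<Rightarrow> nat" where
  "node x = foldl (\<lambda>i b. 2 * i + 1 + of_bool b) 0 x"

fun string_of :: "nat \<Rightarrow> bool list" where
  "string_of 0 = []"
| "string_of (Suc i) = string_of (i div 2) @ [odd i]"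

lemma node_snoc: "node (x @ [b]) = 2 * node x + 1 + of_bool b"
  by (simp add: node_def)

lemma string_of_node [simp]: "string_of (node x) = x"
proof (induction x rule: rev_induct)
  case (snoc b x)
  then show ?case by (cases b) (simp_all add: node_snoc)
qed (simp add: node_def)

lemma string_encode_simps [simp]:
  "string_encode [] = 0"
  "string_encode (b # x) = Suc (prod_encode (of_bool b, string_encode x))"
  by (simp_all add: string_encode_def)

text \<open>Each iteration strips the last bit off the heap number and prepends it to the code of
  the suffix found so far. States with first component \<open>0\<close> are fixed, so
  \<open>i\<close> iterations always suffice.\<close>

lemma computable_string_encode_string_of: "computable A (\<lambda>i. string_encode (string_of i))"
proof -
  define step where "step r = (if pi1 r = 0 then r else prod_encode ((pi1 r - 1) div 2,
    Suc (prod_encode (if even (pi1 r - 1) then 0 else 1, pi2 r))))" for r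
  have "(step ^^ m) (prod_encode (i, string_encode y)) =
      prod_encode (0, string_encode (string_of i @ y))" if "i \<le> m" for i m y
    using that
  proof (induction m arbitrary: i y)
    case (Suc m)
    show ?case
    proof (cases i)
      case 0
      have "(step ^^ k) (prod_encode (0, c)) = prod_encode (0, c)" for k c
        by (induction k) (auto simp: step_def)
      then show ?thesis unfolding 0 by (simp del: funpow.simps)
    next
      case (Suc j)
      have "step (prod_encode (i, string_encode y)) =
          prod_encode (j div 2, string_encode ((odd j) # y))"
        by (auto simp: step_def Suc)
      moreover have "j div 2 \<le> m" using Suc Suc.prems by linarith
      ultimately show ?thesis using Suc.IH[of "j div 2"]
        by (simp add: funpow_Suc_right Suc del: funpow.simps string_encode_simps)
    qed
  qed simp
  from this[of i i "[]" for i]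
  have "pi2 ((step ^^ i) (prod_encode (i, 0))) = string_encode (string_of i)" for i by simp
  moreover have "computable A step"
    unfolding step_def[abs_def] by (intro computable_intros)
  then have "computable A (\<lambda>i. pi2 ((step ^^ i) (prod_encode (i, 0))))"
    by (intro computable_pi2 computable_funpow computable_basic)
  ultimately show ?thesis by simp
qed

text \<open>The code is consumed from the front while the heap number accumulates; a string is no
  longer than its code, which bounds the iterations.\<close>

lemma computable_node:
  obtains nd where "computable A nd" "\<And>x. nd (string_encode x) = node x"
proof -
  define step where "step r = (if pi1 r = 0 then r else prod_encode (pi2 (pi1 r - 1),
    2 * pi2 r + 1 + pi1 (pi1 r - 1)))" for r
  have "(step ^^ m) (prod_encode (string_encode x, a)) =
      prod_encode (0, foldl (\<lambda>i b. 2 * i + 1 + of_bool b) a x)" if "length x \<le> m" for x a m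
    using that
  proof (induction m arbitrary: x a)
    case (Suc m)
    show ?case
    proof (cases x)
      case Nil
      have "(step ^^ k) (prod_encode (0, c)) = prod_encode (0, c)" for k c
        by (induction k) (auto simp: step_def)
      then show ?thesis using Nil by (simp del: funpow.simps)
    next
      case (Cons b y)
      have "step (prod_encode (string_encode x, a)) =
          prod_encode (string_encode y, 2 * a + 1 + of_bool b)"
        by (simp add: step_def Cons)
      then show ?thesis using Suc.IH[of y] Suc.prems Cons
        by (simp add: funpow_Suc_right del: funpow.simps string_encode_simps)
    qed
  qed simp
  moreover have "length x \<le> string_encode x" for x
  proof (induction x)
    case (Cons b x)
    then show ?case
      using le_prod_encode_2[of "string_encode x" "of_bool b"] by simp
  qed simp
  ultimately have "pi2 ((step ^^ string_encode x) (prod_encode (string_encode x, 0))) = node x" for x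
    by (simp add: node_def)
  moreover have "computable A step"
    unfolding step_def[abs_def] by (intro computable_intros)
  then have "computable A (\<lambda>c. pi2 ((step ^^ c) (prod_encode (c, 0))))"
    by (intro computable_pi2 computable_funpow computable_basic)
  ultimately show ?thesis by (rule that[rotated])
qed

text \<open>
  In this numbering \<open>Suc i\<close> is a \<open>1\<close> followed by the bits of the string, so prefixes arise by
  cutting off binary digits.
\<close>

definition ext :: "nat \<Rightarrow> nat \<Rightarrow> bool" where
  "ext i j \<longleftrightarrow> (\<exists>k<Suc j. Suc j div 2 ^ k = Suc i)"

lemma ext_iff: "ext i j \<longleftrightarrow> (\<exists>k. Suc j div 2 ^ k = Suc i)"
proof -
  have "k < Suc j" if "Suc j div 2 ^ k = Suc i" for k
  proof (rule ccontr)
    assume "\<not> k < Suc j"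
    then have "Suc j < 2 ^ k" using less_exp[of k] by linarith
    then show False using that by simp
  qed
  then show ?thesis unfolding ext_def by blast
qed

lemma ext_refl: "ext i i"
  unfolding ext_iff by (rule exI[of _ 0]) simp

lemma ext_imp_le: "ext i j \<Longrightarrow> i \<le> j"
  unfolding ext_iff by (metis Suc_le_mono div_le_dividend)

lemma ext_trans: "ext i j \<Longrightarrow> ext j l \<Longrightarrow> ext i l"
  unfolding ext_iff by (metis div_mult2_eq power_add)

text \<open>Cutting off more digits can be done in two rounds, so the shorter prefix is a prefix of
  the longer one.\<close>

lemma ext_comparable:
  assumes "ext i l" "ext j l"
  shows "ext i j \<or> ext j i"
proof -
  have *: "ext a b" if "Suc l div 2 ^ k = Suc b" "Suc l div 2 ^ m = Suc a" "k \<le> m" for a b k m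
  proof -
    have "Suc b div 2 ^ (m - k) = Suc a"
      using that by (metis div_mult2_eq le_add_diff_inverse power_add)
    then show ?thesis unfolding ext_iff by blast
  qed
  obtain k m where "Suc l div 2 ^ k = Suc i" "Suc l div 2 ^ m = Suc j"
    using assms unfolding ext_iff by blast
  then show ?thesis using * nat_le_linear[of k m] by blast
qed

lemma ext_sons: "ext i (2 * i + 1)" "ext i (2 * i + 2)"
  unfolding ext_iff by (auto intro!: exI[of _ 1])

lemma not_ext_brothers: "\<not> ext (2 * i + 1) (2 * i + 2)"
proof
  assume "ext (2 * i + 1) (2 * i + 2)"
  then obtain k where k: "(2 * i + 3) div 2 ^ k = 2 * i + 2" unfolding ext_iff
    by (auto simp: numeral_3_eq_3)
  show False
  proof (cases k)
    case (Suc m)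
    have "(2 * i + 3) div 2 ^ k \<le> (2 * i + 3) div 2"
      unfolding Suc power_Suc div_mult2_eq by (rule div_le_dividend)
    then show False using k by linarith
  qed (use k in simp)
qed

lemma ext_brothers_disjoint: "ext (2 * i + 1) j \<Longrightarrow> \<not> ext (2 * i + 2) j"
  using ext_comparable[of "2 * i + 1" j "2 * i + 2"] not_ext_brothers
    ext_imp_le[of "2 * i + 2" "2 * i + 1"] by auto

lemma ext_cases:
  assumes "ext i j" "i \<noteq> j"
  shows "ext (2 * i + 1) j \<or> ext (2 * i + 2) j"
proof -
  obtain k where k: "Suc j div 2 ^ k = Suc i" using assms(1) unfolding ext_iff by blast
  have "k \<noteq> 0"
  proof
    assume "k = 0"
    then show False using k assms(2) by simp
  qed
  then obtain m where m: "k = Suc m" using not0_implies_Suc by blast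
  then have "Suc j div 2 ^ m div 2 = Suc i" using k by (metis div_mult2_eq power_Suc2)
  moreover have "n = Suc (2 * i + 1) \<or> n = Suc (2 * i + 2)" if "n div 2 = Suc i" for n
    using that by presburger
  ultimately have "Suc j div 2 ^ m = Suc (2 * i + 1) \<or> Suc j div 2 ^ m = Suc (2 * i + 2)" by blast
  then show ?thesis unfolding ext_iff by blast
qed

section \<open>Antichains, that is, prefix-free sets\<close>

definition antichain :: "nat set \<Rightarrow> bool" where
  "antichain W \<longleftrightarrow> (\<forall>i\<in>W. \<forall>j\<in>W. i \<noteq> j \<longrightarrow> \<not> ext i j)"

lemma antichain_subset: "antichain W \<Longrightarrow> V \<subseteq> W \<Longrightarrow> antichain V"
  unfolding antichain_def by blast

text \<open>A Kraft inequality: unless \<open>W\<close> is empty or \<open>{i}\<close>, it splits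
  into the parts above the two sons of \<open>i\<close>. A bound \<open>N\<close> on the elements of
  \<open>W\<close> makes the descent finite.\<close>

lemma antichain_sum_le:
  fixes f :: "nat \<Rightarrow> real"
  assumes "\<And>i. 0 \<le> f i" "\<And>i. f (2 * i + 1) + f (2 * i + 2) \<le> f i"
    and "finite W" "antichain W" "\<And>j. j \<in> W \<Longrightarrow> ext i j"
  shows "sum f W \<le> f i"
proof -
  obtain N where "\<forall>j\<in>W. j < N"
    using assms(3)[unfolded finite_nat_set_iff_bounded] by (rule exE)
  then show ?thesis using assms(3-)
  proof (induction "N - i" arbitrary: i W rule: less_induct)
    case less
    show ?case
    proof (cases "W = {} \<or> i \<in> W")
      case True
      moreover have "j = i" if "i \<in> W" "j \<in> W" for j
        using less.prems(3,4) that unfolding antichain_def by metis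
      ultimately have "W = {} \<or> W = {i}" by blast
      then show ?thesis using assms(1) by auto
    next
      case False
      then obtain j where "j \<in> W" by blast
      then have "i < N" using less.prems(1,4) ext_imp_le order_le_less_trans by blast
      define W0 where "W0 = {j \<in> W. ext (2 * i + 1) j}"
      define W1 where "W1 = {j \<in> W. ext (2 * i + 2) j}"
      have W: "W = W0 \<union> W1" "W0 \<inter> W1 = {}"
        using False less.prems(4) ext_cases[of i] ext_brothers_disjoint[of i]
        unfolding W0_def W1_def by blast+
      have "sum f W0 \<le> f (2 * i + 1)"
        using less.prems \<open>i < N\<close> antichain_subset[OF less.prems(3), of W0]
        by (intro less.hyps) (auto simp: W0_def)
      moreover have "sum f W1 \<le> f (2 * i + 2)"
        using less.prems \<open>i < N\<close> antichain_subset[OF less.prems(3), of W1]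
        by (intro less.hyps) (auto simp: W1_def)
      moreover have "sum f W = sum f W0 + sum f W1"
        using less.prems(2) W by (metis finite_Un sum.union_disjoint)
      ultimately show ?thesis using assms(2)[of i] by linarith
    qed
  qed
qed

lemma semimeasure_antichain_sum_le:
  assumes "semimeasure m" "finite W" "antichain W"
  shows "(\<Sum>y\<in>W. m (string_of y)) \<le> 1"
proof -
  have "ext 0 j" for j
  proof (induction j rule: less_induct)
    case (less j)
    show ?case
    proof (cases j)
      case (Suc i)
      have "ext (i div 2) j"
        using ext_sons[of "i div 2"] Suc by (cases "even i") (auto elim!: evenE oddE)
      moreover have "i div 2 < j" using Suc by linarith
      ultimately show ?thesis using less ext_trans by blast
    qed (simp add: ext_refl)
  qed
  then have "(\<Sum>y\<in>W. m (string_of y)) \<le> m (string_of 0)"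
    using assms by (intro antichain_sum_le) (auto simp: semimeasure_def)
  also have "\<dots> \<le> 1" using assms(1) unfolding semimeasure_def by blast
  finally show ?thesis .
qed

lemma decidable_ext:
  assumes "computable A f" "computable A g"
  shows "decidable A (\<lambda>x. ext (f x) (g x))"
  unfolding ext_def by (intro computable_intros computable_comp[OF assms(1)]
      computable_comp[OF assms(2)] assms)

lemma decidable_antichain:
  assumes "computable A f"
  shows "decidable A (\<lambda>x. antichain (set_decode (f x)))"
  unfolding antichain_def
  by (intro decidable_all_set_decode decidable_ext computable_intros computable_comp[OF assms] assms)

section \<open>Lower semicomputable semimeasures\<close>

lemma int_decode_parity: "int_decode n = (if even n then int ((n + 1) div 2) else - int ((n + 1) div 2))"
  by (auto simp: int_decode_def sum_decode_def elim!: evenE oddE)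

text \<open>Reduces coded rationals to arithmetic on natural numbers: the sign is a comparison of
  parities, the absolute value a quotient. A zero denominator gives \<open>0\<close> on both
  sides.\<close>

lemma of_rat_nat_to_rat_surj:
  "real_of_rat (nat_to_rat_surj v) =
     (if even (pi1 v) \<longleftrightarrow> even (pi2 v) then 1 else -1) *
     (real ((pi1 v + 1) div 2) / real ((pi2 v + 1) div 2))"
proof -
  have "nat_to_rat_surj v = Fract (int_decode (pi1 v)) (int_decode (pi2 v))"
    by (simp add: nat_to_rat_surj_def pi1_def pi2_def split: prod.split)
  also have "real_of_rat \<dots> = real_of_int (int_decode (pi1 v)) / real_of_int (int_decode (pi2 v))"
    by (cases "int_decode (pi2 v) = 0") (simp_all add: of_rat_rat rat_number_collapse)
  also have "\<dots> = (if even (pi1 v) \<longleftrightarrow> even (pi2 v) then 1 else -1) *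
     (real ((pi1 v + 1) div 2) / real ((pi2 v + 1) div 2))"
  proof -
    have "real_of_int (if P then int a else - int a) / real_of_int (if Q then int b else - int b)
        = (if P \<longleftrightarrow> Q then 1 else -1) * (real a / real b)" for P Q a b
      by simp
    then show ?thesis unfolding int_decode_parity .
  qed
  finally show ?thesis .
qed

lemma scale_eq: "k \<le> s \<Longrightarrow> real (v * 2 ^ (s - k)) / 2 ^ s = real v / 2 ^ k"
proof -
  assume "k \<le> s"
  then have "(2::real) ^ s = 2 ^ (s - k) * 2 ^ k" by (simp flip: power_add)
  then show ?thesis by simp
qed

text \<open>The candidates need not increase with \<open>k\<close>; their running maximum at the
  common denominator \<open>2 ^ s\<close> does, and it has the same supremum.\<close>

lemma lower_semicomputable_SUP:
  assumes "computable A V"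
    and bdd: "\<And>x. bdd_above (range (\<lambda>k. real (V (prod_encode (enc x, k))) / 2 ^ k))"
  shows "lower_semicomputable A enc (\<lambda>x. SUP k. real (V (prod_encode (enc x, k))) / 2 ^ k)"
proof -
  define T where "T c s = bmax (\<lambda>k. V (prod_encode (c, k)) * 2 ^ (s - k)) (Suc s)" for c s
  \<comment> \<open>Even codes denote nonnegative integers, so numerator and denominator are doubled
    to name \<open>T / 2 ^ s\<close>.\<close>
  define q :: "'a \<times> nat \<Rightarrow> rat" where
    "q = (\<lambda>(x, s). nat_to_rat_surj (prod_encode (2 * T (enc x) s, 2 * 2 ^ s)))"
  have q: "real_of_rat (q (x, s)) = real (T (enc x) s) / 2 ^ s" for x s
    unfolding q_def by (simp add: of_rat_nat_to_rat_surj)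
  have comp_T: "computable A (\<lambda>z. T (pi1 z) (pi2 z))"
    unfolding T_def by (intro computable_intros computable_comp[OF assms(1)])
  have "computable A (\<lambda>z. prod_encode (2 * T (pi1 z) (pi2 z), 2 * 2 ^ pi2 z))"
    by (intro computable_intros comp_T)
  then have "computable_rat A (\<lambda>(x, s). prod_encode (enc x, s)) q"
    unfolding computable_def computable_rat_def q_def
    by (auto split: prod.splits) (metis pi1_prod_encode pi2_prod_encode)
  moreover have T_mono: "real (T c s) / 2 ^ s \<le> real (T c (Suc s)) / 2 ^ Suc s" for c s
  proof -
    have "V (prod_encode (c, k)) * 2 ^ (s - k) * 2 \<le> T c (Suc s)" if "k < Suc s" for k
      using bmax_ge[of k "Suc (Suc s)" "\<lambda>k. V (prod_encode (c, k)) * 2 ^ (Suc s - k)"] that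
      unfolding T_def by (simp add: Suc_diff_le)
    then have "T c s * 2 \<le> T c (Suc s)"
      unfolding T_def[of c s] bmax_mult bmax_le_iff by blast
    then have "real (T c s) * 2 \<le> real (T c (Suc s))" by linarith
    then show ?thesis by (simp add: field_simps)
  qed
  then have inc: "incseq (\<lambda>s. real (T c s) / 2 ^ s)" for c by (rule incseq_SucI)
  have "mono (\<lambda>s. q (x, s))" for x
    using inc[of "enc x"] unfolding mono_def q[symmetric] of_rat_less_eq by blast
  moreover have "(\<lambda>s. real_of_rat (q (x, s))) \<longlonglongrightarrow> (SUP k. real (V (prod_encode (enc x, k))) / 2 ^ k)" for x
  proof -
    let ?v = "\<lambda>k. real (V (prod_encode (enc x, k))) / 2 ^ k"
    let ?t = "\<lambda>s. real (T (enc x) s) / 2 ^ s"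
    have le: "?t s \<le> (SUP k. ?v k)" for s
    proof -
      consider "T (enc x) s = 0"
        | k where "k < Suc s" "T (enc x) s = V (prod_encode (enc x, k)) * 2 ^ (s - k)"
        using bmax_in[of "\<lambda>k. V (prod_encode (enc x, k)) * 2 ^ (s - k)" "Suc s", folded T_def] by metis
      then show ?thesis
      proof cases
        case 1
        have "0 \<le> ?v 0" by simp
        also have "\<dots> \<le> (SUP k. ?v k)" by (rule cSUP_upper[OF UNIV_I bdd])
        finally show ?thesis using 1 by simp
      next
        case 2
        then have "?t s = ?v k" using scale_eq[of k s "V (prod_encode (enc x, k))"] by simp
        moreover have "?v k \<le> (SUP k. ?v k)" by (rule cSUP_upper[OF UNIV_I bdd])
        ultimately show ?thesis by simp
      qed
    qed
    then have bdd': "bdd_above (range ?t)" by (rule bdd_aboveI2)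
    have "(SUP s. ?t s) = (SUP k. ?v k)"
    proof (rule antisym)
      show "(SUP s. ?t s) \<le> (SUP k. ?v k)" using le by (intro cSUP_least) auto
      show "(SUP k. ?v k) \<le> (SUP s. ?t s)"
      proof (rule cSUP_mono)
        fix k
        have "V (prod_encode (enc x, k)) \<le> T (enc x) k"
          using bmax_ge[of k "Suc k" "\<lambda>i. V (prod_encode (enc x, i)) * 2 ^ (k - i)"]
          unfolding T_def by simp
        then have "?v k \<le> ?t k" by (simp add: divide_right_mono)
        then show "\<exists>m\<in>UNIV. ?v k \<le> ?t m" by blast
      qed (use bdd' in auto)
    qed
    then show ?thesis using LIMSEQ_incseq_SUP[OF bdd' inc] unfolding q by simp
  qed
  ultimately show ?thesis unfolding lower_semicomputable_def by blast
qed

text \<open>Rounding down to a multiple of \<open>2 ^ -s\<close> keeps the approximations monotone,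
  because the grids are nested, and loses at most \<open>2 ^ -s\<close>, which vanishes in the
  limit. The map \<open>d\<close> lets objects be indexed by numbers.\<close>

lemma lower_semicomputable_dyadic:
  assumes "lower_semicomputable A enc f" "\<And>x. 0 \<le> f x" "computable A (\<lambda>z. enc (d z))"
  obtains u where "computable A (\<lambda>z. u (pi1 z) (pi2 z))"
    and "\<And>z s. 2 * u z s \<le> u z (Suc s)"
    and "\<And>z s. real (u z s) / 2 ^ s \<le> f (d z)"
    and "\<And>z. (\<lambda>s. real (u z s) / 2 ^ s) \<longlonglongrightarrow> f (d z)"
proof -
  obtain q p where "\<forall>y. \<exists>v. run A p (case y of (x, s) \<Rightarrow> prod_encode (enc x, s)) = Some v
      \<and> nat_to_rat_surj v = q y"
    and mono: "\<And>x. mono (\<lambda>s. q (x, s))"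
    and lim: "\<And>x. (\<lambda>s. real_of_rat (q (x, s))) \<longlonglongrightarrow> f x"
    using assms(1) unfolding lower_semicomputable_def computable_rat_def by blast
  then have p: "\<exists>v. run A p (prod_encode (enc x, s)) = Some v \<and> nat_to_rat_surj v = q (x, s)" for x s
    by (metis case_prod_conv)
  define val where "val z s = the (run A p (prod_encode (enc (d z), s)))" for z s
  have val: "run A p (prod_encode (enc (d z), s)) = Some (val z s)"
    "nat_to_rat_surj (val z s) = q (d z, s)" for z s
    using p[of "d z" s] unfolding val_def by auto
  have "computable A (\<lambda>z. prod_encode (enc (d (pi1 z)), pi2 z))"
    by (intro computable_basic computable_comp[OF assms(3)])
  then obtain p' where p': "\<And>z. run A p' z = Some (prod_encode (enc (d (pi1 z)), pi2 z))"
    unfolding computable_def by blast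
  then have "run A (Comp p p') z = Some (val (pi1 z) (pi2 z))" for z using val by simp
  then have comp_val: "computable A (\<lambda>z. val (pi1 z) (pi2 z))" unfolding computable_def by blast
  define r where "r z s = max 0 (real_of_rat (q (d z, s)))" for z s
  have r_le: "r z s \<le> r z s'" if "s \<le> s'" for z s s'
    using monoD[OF mono that] unfolding r_def by (intro max.mono) (simp_all add: of_rat_less_eq)
  have r_lim: "r z \<longlonglongrightarrow> f (d z)" for z
    using tendsto_max[OF tendsto_const[of 0] lim[of "d z"]] assms(2)[of "d z"]
    unfolding r_def[abs_def] by (simp add: max_def)
  \<comment> \<open>The rounded numerator, computed in natural numbers. Different parities mean a
    quotient that is at most \<open>0\<close>, which the truncation in \<open>r\<close> replaces by
    \<open>0\<close>.\<close>
  define u where "u z s = (if even (pi1 (val z s)) \<longleftrightarrow> even (pi2 (val z s))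
    then (2 ^ s * ((pi1 (val z s) + 1) div 2)) div ((pi2 (val z s) + 1) div 2) else 0)" for z s
  have u: "u z s = nat \<lfloor>2 ^ s * r z s\<rfloor>" for z s
  proof -
    have max: "max 0 ((if c then 1 else -1) * t) = (if c then t else 0)" if "0 \<le> t" for c and t :: real
      using that by (auto simp: max_def)
    have "r z s = (if even (pi1 (val z s)) \<longleftrightarrow> even (pi2 (val z s))
      then real ((pi1 (val z s) + 1) div 2) / real ((pi2 (val z s) + 1) div 2) else 0)"
      unfolding r_def val(2)[symmetric] of_rat_nat_to_rat_surj
      by (rule max) simp
    moreover have "(m * a) div b = nat \<lfloor>real m * (real a / real b)\<rfloor>" for m a b
      by (metis floor_divide_of_nat_eq nat_int of_nat_mult times_divide_eq_right)
    from this[of "2 ^ s"] have "(2 ^ s * a) div b = nat \<lfloor>2 ^ s * (real a / real b)\<rfloor>" for a b by simp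
    ultimately show ?thesis unfolding u_def by simp
  qed
  have r_nonneg: "0 \<le> r z s" for z s unfolding r_def by simp
  have u_le: "real (u z s) / 2 ^ s \<le> r z s" for z s
    unfolding u using r_nonneg[of z s] by (simp add: field_simps)
  have u_ge: "r z s - (1 / 2) ^ s \<le> real (u z s) / 2 ^ s" for z s
  proof -
    have "2 ^ s * r z s - 1 \<le> real (u z s)"
      unfolding u using r_nonneg[of z s] by linarith
    then have "(2 ^ s * r z s - 1) / 2 ^ s \<le> real (u z s) / 2 ^ s" by (rule divide_right_mono) simp
    then show ?thesis by (simp add: diff_divide_distrib power_one_over)
  qed
  have "(\<lambda>s. r z s - (1 / 2) ^ s) \<longlonglongrightarrow> f (d z) - 0" for z
    by (intro tendsto_diff r_lim LIMSEQ_power_zero) simp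
  then have "(\<lambda>s. r z s - (1 / 2) ^ s) \<longlonglongrightarrow> f (d z)" for z by simp
  then have u_lim: "(\<lambda>s. real (u z s) / 2 ^ s) \<longlonglongrightarrow> f (d z)" for z
    by (rule tendsto_sandwich[OF always_eventually always_eventually _ r_lim[of z], rotated 2])
      (use u_ge u_le in blast)+
  have u_mono: "2 * u z s \<le> u z (Suc s)" for z s
  proof -
    have "2 * real (u z s) \<le> 2 * (2 ^ s * r z s)" using u_le[of z s] by (simp add: field_simps)
    also have "\<dots> \<le> 2 ^ Suc s * r z (Suc s)" using r_le[of s "Suc s" z] by simp
    finally have "int (2 * u z s) \<le> \<lfloor>2 ^ Suc s * r z (Suc s)\<rfloor>" by (simp add: le_floor_iff)
    then show ?thesis unfolding u[of z "Suc s"] by linarith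
  qed
  have "real (u z s) / 2 ^ s \<le> f (d z)" for z s
  proof -
    have "r z s \<le> f (d z)" using r_le r_lim[of z] by (intro incseq_le) (auto simp: incseq_def)
    then show ?thesis using u_le[of z s] by linarith
  qed
  moreover have "computable A (\<lambda>z. u (pi1 z) (pi2 z))"
    unfolding u_def by (intro computable_intros comp_val)
  ultimately show ?thesis using u_mono u_lim that by blast
qed

lemma scaled_mono:
  assumes "\<And>k. 2 * h k \<le> h (Suc k)" "k \<le> l"
  shows "real (h k) / 2 ^ k \<le> real (h l) / 2 ^ l"
proof -
  have "real (h k) / 2 ^ k \<le> real (h (Suc k)) / 2 ^ Suc k" for k
  proof -
    have "2 * real (h k) \<le> real (h (Suc k))"
      using assms(1)[of k] by (metis of_nat_le_iff of_nat_mult of_nat_numeral)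
    then show ?thesis by (simp add: field_simps)
  qed
  then show ?thesis using lift_Suc_mono_le[of "\<lambda>k. real (h k) / 2 ^ k"] assms(2) by blast
qed

text \<open>
  \<open>H y n k\<close> is the numerator over \<open>2 ^ k\<close> of the \<open>k\<close>-th approximation to the weight of \<open>y\<close>. The
  semimeasure maps \<open>x\<close> to the supremum of the sums of the weights over the antichains above \<open>x\<close>.
\<close>

lemma semimeasure_of_weights:
  fixes H :: "nat \<Rightarrow> nat \<Rightarrow> nat \<Rightarrow> nat"
  assumes comp: "computable A (\<lambda>z. H (pi1 z) (pi1 (pi2 z)) (pi2 (pi2 z)))"
    and H_mono: "\<And>y n k. 2 * H y n k \<le> H y n (Suc k)"
    and H_sum: "\<And>n k W. finite W \<Longrightarrow> antichain W \<Longrightarrow> (\<Sum>y\<in>W. H y n k) \<le> 2 ^ k"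
  shows "\<exists>b. cond_lsc_semimeasure A b \<and> (\<forall>x n k. real (H (node x) n k) / 2 ^ k \<le> b x n)"
proof -
  define ok where "ok i w \<longleftrightarrow> (\<forall>j\<in>set_decode w. ext i j) \<and> antichain (set_decode w)" for i w
  \<comment> \<open>A single index \<open>z\<close> codes an antichain and a stage. The value is
    moved from scale \<open>2 ^ pi2 z\<close> to \<open>2 ^ z\<close>, the form
    \<open>lower_semicomputable_SUP\<close> expects.\<close>
  define V where "V i n z = (if ok i (pi1 z)
    then (\<Sum>y\<in>set_decode (pi1 z). H y n (pi2 z)) * 2 ^ (z - pi2 z) else 0)" for i n z
  define B where "B i n = (SUP z. real (V i n z) / 2 ^ z)" for i n
  have V_eq: "real (V i n z) / 2 ^ z = (if ok i (pi1 z)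
    then \<Sum>y\<in>set_decode (pi1 z). real (H y n (pi2 z)) / 2 ^ pi2 z else 0)" for i n z
    using scale_eq[OF pi2_le[of z], of "\<Sum>y\<in>set_decode (pi1 z). H y n (pi2 z)"] unfolding V_def
    by (simp add: sum_divide_distrib[symmetric])
  have V_le_1: "real (V i n z) / 2 ^ z \<le> 1" for i n z
  proof (cases "ok i (pi1 z)")
    case True
    then have "(\<Sum>y\<in>set_decode (pi1 z). H y n (pi2 z)) \<le> 2 ^ pi2 z"
      unfolding ok_def by (intro H_sum) auto
    then have "(\<Sum>y\<in>set_decode (pi1 z). real (H y n (pi2 z))) \<le> 2 ^ pi2 z"
      by (metis of_nat_le_iff of_nat_numeral of_nat_power of_nat_sum)
    then show ?thesis unfolding V_eq by (simp add: sum_divide_distrib[symmetric])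
  qed (simp add: V_def)
  have bdd: "bdd_above (range (\<lambda>z. real (V i n z) / 2 ^ z))" for i n
    by (rule bdd_aboveI[of _ 1]) (use V_le_1 in blast)
  have B_upper: "real (V i n z) / 2 ^ z \<le> B i n" for i n z
    unfolding B_def by (rule cSUP_upper[OF UNIV_I bdd])
  have weight_le: "(\<Sum>y\<in>W. real (H y n k) / 2 ^ k) \<le> B i n"
    if "finite W" "antichain W" "\<And>j. j \<in> W \<Longrightarrow> ext i j" for W i n k
    using B_upper[of i n "prod_encode (set_encode W, k)"] that unfolding V_eq by (simp add: ok_def)
  have B_nonneg: "0 \<le> B i n" for i n
    using weight_le[of "{}" i n] by (simp add: antichain_def)
  have B_le_1: "B i n \<le> 1" for i n
    unfolding B_def by (intro cSUP_least V_le_1) simp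
  have B_sons: "B (2 * i + 1) n + B (2 * i + 2) n \<le> B i n" for i n
  proof -
    \<comment> \<open>Antichains above the two sons are incomparable with each other, so their union
      is an antichain above \<open>i\<close>; both sums are raised to a common stage.\<close>
    have *: "real (V (2 * i + 1) n z0) / 2 ^ z0 + real (V (2 * i + 2) n z1) / 2 ^ z1 \<le> B i n" for z0 z1
    proof -
      define W where "W z j = (if ok j (pi1 z) then set_decode (pi1 z) else {})" for z j
      define W0 where "W0 = W z0 (2 * i + 1)"
      define W1 where "W1 = W z1 (2 * i + 2)"
      define k where "k = max (pi2 z0) (pi2 z1)"
      have W0: "finite W0" "antichain W0" "\<And>j. j \<in> W0 \<Longrightarrow> ext (2 * i + 1) j"
        and W1: "finite W1" "antichain W1" "\<And>j. j \<in> W1 \<Longrightarrow> ext (2 * i + 2) j"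
        unfolding W0_def W1_def W_def ok_def by (auto simp: antichain_def split: if_splits)
      have disj: "W0 \<inter> W1 = {}" using W0(3) W1(3) ext_brothers_disjoint by blast
      have "\<not> ext j0 j1 \<and> \<not> ext j1 j0" if "j0 \<in> W0" "j1 \<in> W1" for j0 j1
        using W0(3)[OF that(1)] W1(3)[OF that(2)] ext_brothers_disjoint ext_trans by blast
      then have anti: "antichain (W0 \<union> W1)"
        using W0(2) W1(2) unfolding antichain_def by blast
      have ext: "ext i j" if "j \<in> W0 \<union> W1" for j
        using that W0(3) W1(3) ext_sons ext_trans by blast
      have V_le: "real (V j n z) / 2 ^ z \<le> (\<Sum>y\<in>W z j. real (H y n k) / 2 ^ k)" if "pi2 z \<le> k" for j z
        unfolding V_eq W_def using that by (auto intro!: sum_mono scaled_mono H_mono)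
      have "real (V (2 * i + 1) n z0) / 2 ^ z0 + real (V (2 * i + 2) n z1) / 2 ^ z1
          \<le> (\<Sum>y\<in>W0. real (H y n k) / 2 ^ k) + (\<Sum>y\<in>W1. real (H y n k) / 2 ^ k)"
        unfolding W0_def W1_def by (intro add_mono V_le) (auto simp: k_def)
      also have "\<dots> = (\<Sum>y\<in>W0 \<union> W1. real (H y n k) / 2 ^ k)"
        using W0(1) W1(1) disj by (simp add: sum.union_disjoint)
      also have "\<dots> \<le> B i n" using anti ext W0(1) W1(1) by (intro weight_le) auto
      finally show ?thesis .
    qed
    \<comment> \<open>The bound holds for all pairs of candidates, so the two suprema can be taken
      one after the other.\<close>
    have "B (2 * i + 2) n \<le> B i n - real (V (2 * i + 1) n z0) / 2 ^ z0" for z0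
      unfolding B_def[of "2 * i + 2"] using *[of z0] by (intro cSUP_least) (auto simp: algebra_simps)
    then have "real (V (2 * i + 1) n z0) / 2 ^ z0 \<le> B i n - B (2 * i + 2) n" for z0
      by (simp add: algebra_simps)
    then have "B (2 * i + 1) n \<le> B i n - B (2 * i + 2) n"
      unfolding B_def[of "2 * i + 1"] by (intro cSUP_least) auto
    then show ?thesis by linarith
  qed
  obtain nd where nd: "computable A nd" "\<And>x. nd (string_encode x) = node x"
    using computable_node by blast
  define b where "b x n = B (node x) n" for x n
  have "semimeasure (\<lambda>x. b x n)" for n
    unfolding semimeasure_def b_def
    using B_nonneg B_le_1 B_sons[of "node y" n for y] by (simp add: node_snoc)
  moreover have "lower_semicomputable A (\<lambda>(x, n). prod_encode (string_encode x, n)) (\<lambda>(x, n). b x n)"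
  proof -
    define V' where "V' z = V (nd (pi1 (pi1 z))) (pi2 (pi1 z)) (pi2 z)" for z
    have "computable A V'"
      unfolding V'_def V_def ok_def
      by (intro computable_sum_set_decode decidable_all_set_decode decidable_ext decidable_antichain
          computable_intros computable_comp[OF nd(1)] computable_comp3[OF comp])
    from lower_semicomputable_SUP[OF this, of "\<lambda>(x, n). prod_encode (string_encode x, n)"]
    show ?thesis using bdd by (simp add: V'_def nd(2) b_def B_def split_def)
  qed
  ultimately have "cond_lsc_semimeasure A b" unfolding cond_lsc_semimeasure_def by blast
  moreover have "real (H (node x) n k) / 2 ^ k \<le> b x n" for x n k
    using weight_le[of "{node x}" "node x" n k] unfolding b_def by (simp add: antichain_def ext_refl)
  ultimately show ?thesis by blast
qed

lemma cond_lsc_semimeasure_instance: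
  assumes "cond_lsc_semimeasure A b"
  shows "lsc_semimeasure A (\<lambda>x. b x n)"
proof -
  obtain q p where p: "\<And>x n s. \<exists>v. run A p (prod_encode (prod_encode (string_encode x, n), s)) = Some v
      \<and> nat_to_rat_surj v = q ((x, n), s)"
    and mono: "\<And>x n. mono (\<lambda>s. q ((x, n), s))"
    and lim: "\<And>x n. (\<lambda>s. real_of_rat (q ((x, n), s))) \<longlonglongrightarrow> b x n"
    using assms unfolding cond_lsc_semimeasure_def lower_semicomputable_def computable_rat_def
    by fastforce
  have "computable A (\<lambda>z. prod_encode (prod_encode (pi1 z, n), pi2 z))"
    by (intro computable_basic)
  then obtain p' where "\<And>z. run A p' z = Some (prod_encode (prod_encode (pi1 z, n), pi2 z))"
    unfolding computable_def by blast
  then have p': "run A (Comp p p') (prod_encode (string_encode x, s)) =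
      run A p (prod_encode (prod_encode (string_encode x, n), s))" for x s
    by simp
  have "computable_rat A (\<lambda>(x, s). prod_encode (string_encode x, s)) (\<lambda>(x, s). q ((x, n), s))"
    unfolding computable_rat_def
  proof (intro exI[of _ "Comp p p'"] allI)
    fix xs :: "bool list \<times> nat"
    show "\<exists>v. run A (Comp p p') (case xs of (x, s) \<Rightarrow> prod_encode (string_encode x, s)) = Some v \<and>
        nat_to_rat_surj v = (case xs of (x, s) \<Rightarrow> q ((x, n), s))"
      using p p' by (cases xs) (simp del: run.simps)
  qed
  then have "lower_semicomputable A string_encode (\<lambda>x. b x n)"
    unfolding lower_semicomputable_def
    using mono lim by (intro exI[of _ "\<lambda>(x, s). q ((x, n), s)"]) auto
  then show ?thesis
    using assms unfolding lsc_semimeasure_def cond_lsc_semimeasure_def by blast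
qed

section \<open>Comparison with the limit\<close>

text \<open>A bound strictly below \<open>m x\<close> is exceeded at a finite stage
  \<open>s\<close>. That stage depends on finitely many guessed values, so for all large
  \<open>n\<close> it is computed correctly and passes the antichain test.\<close>

lemma liminf_dominates_halting_semimeasure:
  assumes "lsc_semimeasure halting_problem m"
  obtains b where "cond_lsc_semimeasure {} b"
    and "\<And>x r. r < m x \<Longrightarrow> \<forall>\<^sub>F n in sequentially. r \<le> b x n"
proof -
  have m: "semimeasure m" "lower_semicomputable halting_problem string_encode m"
    using assms unfolding lsc_semimeasure_def by auto
  then have "\<And>x. 0 \<le> m x" unfolding semimeasure_def by blast
  from lower_semicomputable_dyadic[OF m(2) this computable_string_encode_string_of]
  obtain u where comp_u: "computable halting_problem (\<lambda>z. u (pi1 z) (pi2 z))"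
    and u_mono: "\<And>y s. 2 * u y s \<le> u y (Suc s)"
    and u_le: "\<And>y s. real (u y s) / 2 ^ s \<le> m (string_of y)"
    and u_lim: "\<And>y. (\<lambda>s. real (u y s) / 2 ^ s) \<longlonglongrightarrow> m (string_of y)"
    by blast
  obtain g where g: "computable {} g"
    "\<And>z. \<forall>\<^sub>F n in sequentially. g (prod_encode (z, n)) = u (pi1 z) (pi2 z)"
    using limit_lemma[OF comp_u] by blast
  define v where "v y s n = g (prod_encode (prod_encode (y, s), n))" for y s n
  have v_lim: "\<forall>\<^sub>F n in sequentially. v y s n = u y s" for y s
    using g(2)[of "prod_encode (y, s)"] by (simp add: v_def)
  \<comment> \<open>Guesses at time \<open>n\<close> may be wrong and decrease in \<open>s\<close>;
    the running maximum restores monotonicity.\<close>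
  define M where "M y s n = bmax (\<lambda>s'. v y s' n * 2 ^ (s - s')) (Suc s)" for y s n
  \<comment> \<open>Numbers below \<open>2 ^ s\<close> code the subsets of \<open>{..<s}\<close>, so
    the test is finite; accordingly \<open>H\<close> counts stage \<open>s\<close> only at nodes
    \<open>y < s\<close>.\<close>
  define good where "good s n \<longleftrightarrow> (\<forall>w<2 ^ s. antichain (set_decode w) \<longrightarrow>
    (\<Sum>y\<in>set_decode w. M y s n) \<le> 2 ^ s)" for s n
  define H where "H y n k = bmax (\<lambda>s. if s \<le> n \<and> y < s \<and> good s n
    then M y s n * 2 ^ (k - s) else 0) (Suc k)" for y n k
  have M_le: "M y s n * 2 ^ (t - s) \<le> M y t n" if "s \<le> t" for y s t n
    unfolding M_def[of y s] bmax_mult bmax_le_iff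
  proof (intro allI impI)
    fix s' assume "s' < Suc s"
    then have "v y s' n * 2 ^ (s - s') * 2 ^ (t - s) = v y s' n * 2 ^ (t - s')"
      using that by (simp flip: power_add)
    also have "\<dots> \<le> M y t n"
      unfolding M_def using \<open>s' < Suc s\<close> that by (intro bmax_ge) auto
    finally show "v y s' n * 2 ^ (s - s') * 2 ^ (t - s) \<le> M y t n" .
  qed
  have comp_M: "computable {} (\<lambda>z. M (pi1 z) (pi1 (pi2 z)) (pi2 (pi2 z)))"
    unfolding M_def v_def by (intro computable_intros computable_comp[OF g(1)])
  have "computable {} (\<lambda>z. H (pi1 z) (pi1 (pi2 z)) (pi2 (pi2 z)))"
    unfolding H_def good_def
    by (intro computable_sum_set_decode decidable_antichain computable_intros
        computable_comp3[OF comp_M])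
  moreover have "2 * H y n k \<le> H y n (Suc k)" for y n k
  proof -
    have "H y n k * 2 \<le> H y n (Suc k)"
      unfolding H_def[of y n k] bmax_mult bmax_le_iff
    proof (intro allI impI)
      fix s assume "s < Suc k"
      then show "(if s \<le> n \<and> y < s \<and> good s n then M y s n * 2 ^ (k - s) else 0) * 2 \<le> H y n (Suc k)"
        unfolding H_def
        using bmax_ge[of s "Suc (Suc k)" "\<lambda>s. if s \<le> n \<and> y < s \<and> good s n
          then M y s n * 2 ^ (Suc k - s) else 0"] by (auto simp: Suc_diff_le)
    qed
    then show ?thesis by simp
  qed
  moreover have "(\<Sum>y\<in>W. H y n k) \<le> 2 ^ k" if "finite W" "antichain W" for n k W
  proof -
    \<comment> \<open>By monotonicity of \<open>M\<close> the largest accepted stage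
      \<open>t\<close> dominates all others, so its test bounds the whole sum.\<close>
    define S where "S = {s. s \<le> k \<and> s \<le> n \<and> good s n}"
    show ?thesis
    proof (cases "S = {}")
      case True
      then have "H y n k \<le> 0" for y
        unfolding H_def bmax_le_iff S_def by auto
      then show ?thesis by simp
    next
      case False
      have "finite S" unfolding S_def by simp
      define t where "t = Max S"
      have t: "t \<le> k" "t \<le> n" "good t n"
        using Max_in[OF \<open>finite S\<close> False] unfolding t_def S_def by auto
      have H_le: "H y n k \<le> (if y < t then M y t n * 2 ^ (k - t) else 0)" for y
        unfolding H_def bmax_le_iff
      proof (intro allI impI)
        fix s assume s: "s < Suc k"
        show "(if s \<le> n \<and> y < s \<and> good s n then M y s n * 2 ^ (k - s) else 0)
          \<le> (if y < t then M y t n * 2 ^ (k - t) else 0)"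
        proof (cases "s \<le> n \<and> y < s \<and> good s n")
          case True
          then have "s \<in> S" using s unfolding S_def by auto
          then have st: "s \<le> t" using \<open>finite S\<close> unfolding t_def by simp
          have "M y s n * 2 ^ (k - s) = M y s n * 2 ^ (t - s) * 2 ^ (k - t)"
            using st t(1) by (simp flip: power_add)
          also have "\<dots> \<le> M y t n * 2 ^ (k - t)" using M_le[OF st] by simp
          finally show ?thesis using True st by simp
        qed auto
      qed
      define W' where "W' = W \<inter> {..<t}"
      have "set_encode W' < 2 ^ t" unfolding W'_def by (rule set_encode_less) simp
      moreover have W': "set_decode (set_encode W') = W'" "antichain W'"
        using that antichain_subset unfolding W'_def by auto
      ultimately have sum: "(\<Sum>y\<in>W'. M y t n) \<le> 2 ^ t"
        using t(3) unfolding good_def by metis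
      have "(\<Sum>y\<in>W. H y n k) \<le> (\<Sum>y\<in>W. if y \<in> {..<t} then M y t n * 2 ^ (k - t) else 0)"
        using H_le by (intro sum_mono) simp
      also have "\<dots> = (\<Sum>y\<in>W'. M y t n) * 2 ^ (k - t)"
        unfolding W'_def sum_distrib_right by (rule sum.inter_restrict[symmetric, OF that(1)])
      also have "\<dots> \<le> 2 ^ t * 2 ^ (k - t)" using sum by simp
      also have "\<dots> = 2 ^ k" using t(1) by (simp flip: power_add)
      finally show ?thesis .
    qed
  qed
  ultimately have "\<exists>b. cond_lsc_semimeasure {} b \<and>
      (\<forall>x n k. real (H (node x) n k) / 2 ^ k \<le> b x n)"
    by (rule semimeasure_of_weights)
  then obtain b where b: "cond_lsc_semimeasure {} b"
    "\<And>x n k. real (H (node x) n k) / 2 ^ k \<le> b x n"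
    by blast
  have "\<forall>\<^sub>F n in sequentially. r \<le> b x n" if "r < m x" for x r
  proof -
    have "\<forall>\<^sub>F s in sequentially. r < real (u (node x) s) / 2 ^ s"
      using order_tendstoD(1)[OF u_lim[of "node x"]] that by simp
    with eventually_gt_at_top[of "node x"]
    have "\<forall>\<^sub>F s in sequentially. node x < s \<and> r < real (u (node x) s) / 2 ^ s"
      by eventually_elim simp
    from eventually_happens[OF this]
    obtain s where s: "node x < s" "r < real (u (node x) s) / 2 ^ s" by auto
    have "\<forall>\<^sub>F n in sequentially. \<forall>p\<in>{..<s} \<times> {..s}. v (fst p) (snd p) n = u (fst p) (snd p)"
      using v_lim by (intro eventually_ball_finite) auto
    with eventually_ge_at_top[of s] show ?thesis
    proof eventually_elim
      case (elim n)
      \<comment> \<open>The true numerators increase at scale, so with correct guesses the running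
        maximum is the last value.\<close>
      have M_eq: "M y s n = u y s" if "y < s" for y
      proof -
        have v_eq: "v y s' n = u y s'" if "s' \<le> s" for s' using elim(2) \<open>y < s\<close> that by auto
        have "u y s' * 2 ^ (s - s') \<le> u y s" if "s' \<le> s" for s'
        proof -
          have "real (u y s' * 2 ^ (s - s')) / 2 ^ s \<le> real (u y s) / 2 ^ s"
            unfolding scale_eq[OF that] by (rule scaled_mono[of "u y", OF u_mono that])
          then show ?thesis by (simp add: divide_le_cancel del: of_nat_mult)
        qed
        then have "M y s n \<le> u y s" unfolding M_def bmax_le_iff using v_eq by simp
        moreover have "u y s \<le> M y s n"
          using bmax_ge[of s "Suc s" "\<lambda>s'. v y s' n * 2 ^ (s - s')"] v_eq[of s] unfolding M_def by simp
        ultimately show ?thesis by simp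
      qed
      have "good s n" unfolding good_def
      proof (intro allI impI)
        fix w :: nat assume w: "w < 2 ^ s" "antichain (set_decode w)"
        have "y < s" if "y \<in> set_decode w" for y
        proof -
          have "(2::nat) ^ y < 2 ^ s" using set_decode_imp_power_le[OF that] w(1) by linarith
          then show ?thesis by simp
        qed
        then have "real (\<Sum>y\<in>set_decode w. M y s n) / 2 ^ s = (\<Sum>y\<in>set_decode w. real (u y s) / 2 ^ s)"
          using M_eq by (simp add: sum_divide_distrib)
        also have "\<dots> \<le> (\<Sum>y\<in>set_decode w. m (string_of y))" by (intro sum_mono u_le)
        also have "\<dots> \<le> 1" using semimeasure_antichain_sum_le[OF m(1) _ w(2)] by simp
        finally have "real (\<Sum>y\<in>set_decode w. M y s n) \<le> real (2 ^ s)" by (simp add: field_simps)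
        then show "(\<Sum>y\<in>set_decode w. M y s n) \<le> 2 ^ s" by linarith
      qed
      then have "M (node x) s n \<le> H (node x) n s"
        using bmax_ge[of s "Suc s" "\<lambda>s'. if s' \<le> n \<and> node x < s' \<and> good s' n
          then M (node x) s' n * 2 ^ (s - s') else 0"] s(1) elim(1) unfolding H_def by simp
      then have "real (u (node x) s) / 2 ^ s \<le> real (H (node x) n s) / 2 ^ s"
        using M_eq[OF s(1)] by (simp add: divide_right_mono)
      then show ?case using s(2) b(2)[of x n s] by linarith
    qed
  qed
  then show ?thesis using b(1) that by blast
qed

text \<open>Only thresholds that are powers of \<open>1/2\<close> are matched, so that requests can
  be numbered; rounding to such a power costs a bounded factor.\<close>

lemma halting_semimeasure_dominates_liminf:
  assumes "cond_lsc_semimeasure {} a"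
  obtains b where "lsc_semimeasure halting_problem b"
    and "\<And>x j. \<forall>\<^sub>F n in sequentially. (1 / 2) ^ j \<le> a x n \<Longrightarrow> (1 / 2) ^ j \<le> b x"
proof -
  let ?enc = "\<lambda>(x, n). prod_encode (string_encode x, n)"
  define d where "d z = (string_of (pi1 z), pi2 z)" for z
  have a: "\<And>n. semimeasure (\<lambda>x. a x n)" "lower_semicomputable {} ?enc (\<lambda>(x, n). a x n)"
    using assms unfolding cond_lsc_semimeasure_def by auto
  have a_nonneg: "0 \<le> a x n" for x n using a(1)[of n] unfolding semimeasure_def by blast
  have comp_enc: "computable {} (\<lambda>z. ?enc (d z))" unfolding d_def
    by (simp add: computable_basic computable_comp[OF computable_string_encode_string_of])
  have "\<And>xn. 0 \<le> (case xn of (x, n) \<Rightarrow> a x n)"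
    using a_nonneg by (simp split: prod.split)
  from lower_semicomputable_dyadic[OF a(2) this comp_enc]
  obtain u where comp_u: "computable {} (\<lambda>z. u (pi1 z) (pi2 z))"
    and "\<And>z t. 2 * u z t \<le> u z (Suc t)"
    and u_le: "\<And>z t. real (u z t) / 2 ^ t \<le> (case d z of (x, n) \<Rightarrow> a x n)"
    and u_lim: "\<And>z. (\<lambda>t. real (u z t) / 2 ^ t) \<longlonglongrightarrow> (case d z of (x, n) \<Rightarrow> a x n)"
    by blast
  define v where "v y n t = u (prod_encode (y, n)) t" for y n t
  have v_le: "real (v y n t) / 2 ^ t \<le> a (string_of y) n"
    and v_lim: "(\<lambda>t. real (v y n t) / 2 ^ t) \<longlonglongrightarrow> a (string_of y) n" for y n t
    using u_le[of "prod_encode (y, n)" t] u_lim[of "prod_encode (y, n)"] by (simp_all add: v_def d_def)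

  \<comment> \<open>Stage \<open>k\<close> of the construction asks to raise the weight of the node \<open>pi1 (pi1 k)\<close> to
    \<open>2\<close> to the power \<open>- pi2 (pi1 k)\<close>; every request is repeated at infinitely many stages. A set of
    granted requests is coded by a number \<open>e\<close>, and \<open>G e\<close> is the resulting weight at scale \<open>2 ^ t\<close>.\<close>
  define G where "G e y t = bmax (\<lambda>k. if k \<in> set_decode e \<and> pi1 (pi1 k) = y
    then 2 ^ (t - pi2 (pi1 k)) else 0) e" for e y t
  \<comment> \<open>The scale-free value of \<open>G\<close>. The two agree once \<open>t\<close>
    bounds all granted stages; for smaller \<open>t\<close> the truncated difference in
    \<open>G\<close> may distort it.\<close>
  define weight :: "nat \<Rightarrow> nat \<Rightarrow> real" where
    "weight e y = Max (insert 0 ((\<lambda>k. (1 / 2) ^ pi2 (pi1 k)) ` {k \<in> set_decode e. pi1 (pi1 k) = y}))"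
    for e y
  have weight_le_iff: "weight e y \<le> c \<longleftrightarrow>
      0 \<le> c \<and> (\<forall>k\<in>set_decode e. pi1 (pi1 k) = y \<longrightarrow> (1 / 2) ^ pi2 (pi1 k) \<le> c)" for e y c
    unfolding weight_def by (subst Max_le_iff) auto
  have weight_ge: "(1 / 2) ^ pi2 (pi1 k) \<le> weight e (pi1 (pi1 k))" if "k \<in> set_decode e" for e k
    using weight_le_iff[of e "pi1 (pi1 k)" "weight e (pi1 (pi1 k))"] that by blast
  have weight_nonneg: "0 \<le> weight e y" for e y
    using weight_le_iff[of e y "weight e y"] by blast
  have exponent_le: "pi2 (pi1 k) \<le> k" for k using pi1_le pi2_le le_trans by meson
  have power_scale: "real (2 ^ (t - j)) / 2 ^ t = (1 / 2) ^ j" if "j \<le> t" for j t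
    using scale_eq[OF that, of 1] by (simp add: power_one_over)
  have G_eq: "real (G e y t) / 2 ^ t = weight e y" if e: "\<And>k. k \<in> set_decode e \<Longrightarrow> k \<le> t" for e y t
  proof (rule antisym)
    have le: "pi2 (pi1 k) \<le> t" if "k \<in> set_decode e" for k
      using exponent_le[of k] e[OF that] by linarith
    have "G e y t = 0 \<or> (\<exists>k\<in>set_decode e. pi1 (pi1 k) = y \<and> G e y t = 2 ^ (t - pi2 (pi1 k)))"
      using bmax_in[of "\<lambda>k. if k \<in> set_decode e \<and> pi1 (pi1 k) = y
          then 2 ^ (t - pi2 (pi1 k)) else 0" e, folded G_def] by (metis (full_types))
    then show "real (G e y t) / 2 ^ t \<le> weight e y"
      using weight_nonneg weight_ge power_scale[OF le] by force
    have "(1 / 2) ^ pi2 (pi1 k) \<le> real (G e y t) / 2 ^ t" if "k \<in> set_decode e" "pi1 (pi1 k) = y" for k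
    proof -
      have "2 ^ (t - pi2 (pi1 k)) \<le> G e y t"
        using bmax_ge[OF set_decode_less[OF that(1)], of "\<lambda>k. if k \<in> set_decode e \<and> pi1 (pi1 k) = y
          then 2 ^ (t - pi2 (pi1 k)) else 0"] that unfolding G_def by simp
      then have "real (2 ^ (t - pi2 (pi1 k))) \<le> real (G e y t)" by (rule of_nat_mono)
      then show ?thesis unfolding power_scale[OF le[OF that(1)], symmetric]
        by (rule divide_right_mono) simp
    qed
    then show "weight e y \<le> real (G e y t) / 2 ^ t" unfolding weight_le_iff by simp
  qed

  \<comment> \<open>\<open>R z m\<close> reports an overflow for the request set
    \<open>pi2 z\<close> from stage \<open>pi1 z\<close> on. The number \<open>m\<close> codes the
    antichain and the offsets of the condition and of the precision, so both are at least
    \<open>pi1 z\<close>.\<close>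
  define R where "R z m \<longleftrightarrow> antichain (set_decode (pi1 m)) \<and>
    2 ^ (pi1 z + pi2 (pi2 m)) < (\<Sum>y\<in>set_decode (pi1 m).
      max (v y (pi1 z + pi1 (pi2 m)) (pi1 z + pi2 (pi2 m))) (G (pi2 z) y (pi1 z + pi2 (pi2 m))))" for z m
  define grant where "grant z \<longleftrightarrow> \<not> (\<exists>m. R z m)" for z
  \<comment> \<open>The exact property that \<open>grant\<close> tests: the least semimeasure above
    the maxima has root value at most \<open>1\<close>.\<close>
  define fits where "fits s e \<longleftrightarrow> (\<forall>n\<ge>s. \<forall>W. finite W \<longrightarrow> antichain W \<longrightarrow>
    (\<Sum>y\<in>W. max (a (string_of y) n) (weight e y)) \<le> 1)" for s e
  have "computable {} (\<lambda>z. v (pi1 z) (pi1 (pi2 z)) (pi2 (pi2 z)))"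
    unfolding v_def by (intro computable_comp2[OF comp_u] computable_basic)
  note comp_v = computable_comp3[OF this]
  have "computable A (\<lambda>z. G (pi1 z) (pi1 (pi2 z)) (pi2 (pi2 z)))" for A
    unfolding G_def by (intro computable_intros)
  note comp_G = computable_comp3[OF this]
  have "decidable {} (\<lambda>z. R (pi1 z) (pi2 z))"
    unfolding R_def
    by (intro computable_sum_set_decode decidable_antichain computable_intros comp_v comp_G)
  then have dec_grant: "decidable halting_problem grant"
    unfolding grant_def[abs_def] by (intro decidable_not decidable_halting_ex)

  have scaled: "real (\<Sum>y\<in>W. max (v y n t) (G e y t)) / 2 ^ t =
      (\<Sum>y\<in>W. max (real (v y n t) / 2 ^ t) (weight e y))"
    if "\<And>k. k \<in> set_decode e \<Longrightarrow> k \<le> t" for W n t e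
  proof -
    have "real (max i j) / 2 ^ t = max (real i / 2 ^ t) (real j / 2 ^ t)" for i j
      by (auto simp: max_def divide_le_cancel)
    then show ?thesis using G_eq[OF that] by (simp add: sum_divide_distrib)
  qed
  \<comment> \<open>The approximations \<open>v\<close> converge to \<open>a\<close> from below, so
    antichain sums stay at most \<open>1\<close> in the limit exactly if they do at every precision
    \<open>t \<ge> s\<close>. The bound on \<open>e\<close> makes \<open>G\<close> exact at these
    precisions.\<close>
  have grant_iff: "grant (prod_encode (s, e)) \<longleftrightarrow> fits s e"
    if e: "\<And>k. k \<in> set_decode e \<Longrightarrow> k \<le> s" for s e
  proof
    assume grant: "grant (prod_encode (s, e))"
    show "fits s e" unfolding fits_def
    proof (intro allI impI)
      fix n W assume n: "s \<le> n" and W: "finite W" "antichain W"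
      have "(\<Sum>y\<in>W. max (real (v y n t) / 2 ^ t) (weight e y)) \<le> 1" if "s \<le> t" for t
      proof -
        have "\<not> R (prod_encode (s, e)) (prod_encode (set_encode W, prod_encode (n - s, t - s)))"
          using grant unfolding grant_def by blast
        then have "(\<Sum>y\<in>W. max (v y n t) (G e y t)) \<le> 2 ^ t"
          using W n that unfolding R_def by simp
        then have "real (\<Sum>y\<in>W. max (v y n t) (G e y t)) \<le> real (2 ^ t)" by (rule of_nat_mono)
        then have "real (\<Sum>y\<in>W. max (v y n t) (G e y t)) / 2 ^ t \<le> 1" by (simp del: of_nat_sum)
        moreover have "k \<le> t" if "k \<in> set_decode e" for k using e[OF that] \<open>s \<le> t\<close> by simp
        ultimately show ?thesis by (simp only: scaled)
      qed
      moreover have "(\<lambda>t. \<Sum>y\<in>W. max (real (v y n t) / 2 ^ t) (weight e y)) \<longlonglongrightarrow>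
          (\<Sum>y\<in>W. max (a (string_of y) n) (weight e y))"
        by (intro tendsto_sum tendsto_max v_lim tendsto_const)
      ultimately show "(\<Sum>y\<in>W. max (a (string_of y) n) (weight e y)) \<le> 1"
        by (meson LIMSEQ_le_const2)
    qed
  next
    assume fits: "fits s e"
    show "grant (prod_encode (s, e))" unfolding grant_def
    proof
      assume "\<exists>m. R (prod_encode (s, e)) m"
      then obtain m where m: "R (prod_encode (s, e)) m" by blast
      define W where "W = set_decode (pi1 m)"
      define n where "n = s + pi1 (pi2 m)"
      define t where "t = s + pi2 (pi2 m)"
      have W: "finite W" "antichain W" and gt: "2 ^ t < (\<Sum>y\<in>W. max (v y n t) (G e y t))"
        using m unfolding R_def W_def n_def t_def by auto
      have t: "k \<le> t" if "k \<in> set_decode e" for k using e[OF that] unfolding t_def by simp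
      have "real (\<Sum>y\<in>W. max (v y n t) (G e y t)) / 2 ^ t
          = (\<Sum>y\<in>W. max (real (v y n t) / 2 ^ t) (weight e y))"
        by (rule scaled) (rule t)
      also have "\<dots> \<le> (\<Sum>y\<in>W. max (a (string_of y) n) (weight e y))"
        by (intro sum_mono max.mono v_le order_refl)
      also have "\<dots> \<le> 1" using fits W unfolding fits_def n_def by simp
      finally have "real (\<Sum>y\<in>W. max (v y n t) (G e y t)) \<le> real (2 ^ t)"
        by (simp add: field_simps)
      then show False using gt by linarith
    qed
  qed

  \<comment> \<open>\<open>E s\<close> codes the requests granted before stage \<open>s\<close>;
    adding \<open>2 ^ s\<close> inserts request \<open>s\<close>.\<close>
  define E where "E = rec_nat 0 (\<lambda>s e. if grant (prod_encode (s, 2 ^ s + e)) then 2 ^ s + e else e)"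
  have E_0: "E 0 = 0"
    and E_Suc: "E (Suc s) = (if grant (prod_encode (s, 2 ^ s + E s)) then 2 ^ s + E s else E s)" for s
    unfolding E_def by simp_all
  have comp_E: "computable halting_problem E"
    unfolding E_def by (intro computable_rec_nat computable_intros decidable_comp[OF dec_grant])
  have "\<forall>k\<in>set_decode (E s). k < s" for s
  proof (induction s)
    case (Suc s)
    then have "s \<notin> set_decode (E s)" by blast
    then show ?case using Suc by (auto simp: E_Suc set_decode_plus_power_2 less_Suc_eq)
  qed (simp add: E_0)
  then have E_less: "\<And>k s. k \<in> set_decode (E s) \<Longrightarrow> k < s" by blast
  have insert: "set_decode (2 ^ s + E s) = insert s (set_decode (E s))" for s
    using E_less[of s s] by (intro set_decode_plus_power_2) blast
  have E_mono: "set_decode (E s) \<subseteq> set_decode (E (Suc s))" for s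
    by (simp add: E_Suc insert subset_insertI)
  have E_fits: "fits s (E s)" for s
  proof (induction s)
    case 0
    show ?case
      unfolding fits_def E_0 weight_def
      using semimeasure_antichain_sum_le[OF a(1)] a_nonneg by (simp add: max_absorb1)
  next
    case (Suc s)
    have "fits s (E (Suc s))"
    proof (cases "grant (prod_encode (s, 2 ^ s + E s))")
      case True
      have "k \<le> s" if "k \<in> set_decode (2 ^ s + E s)" for k
        using that E_less[of k s] unfolding insert by auto
      from grant_iff[OF this] True show ?thesis by (simp add: E_Suc)
    qed (use Suc in \<open>simp add: E_Suc\<close>)
    \<comment> \<open>\<open>fits\<close> only weakens as its first argument grows, since fewer
      conditions remain.\<close>
    then show ?case unfolding fits_def by simp
  qed

  \<comment> \<open>An unconditional construction, presented as constant in \<open>n\<close> and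
    read off at \<open>n = 0\<close> in the end.\<close>
  define H where "H y (n::nat) k = G (E k) y k" for y n k
  have H_eq: "real (H y n k) / 2 ^ k = weight (E k) y" for y n k
    unfolding H_def using E_less by (intro G_eq) (simp add: less_imp_le)
  have "computable halting_problem (\<lambda>z. H (pi1 z) (pi1 (pi2 z)) (pi2 (pi2 z)))"
    unfolding H_def by (intro comp_G computable_comp[OF comp_E] computable_basic)
  moreover have "2 * H y n k \<le> H y n (Suc k)" for y n k
  proof -
    have "weight (E k) y \<le> weight (E (Suc k)) y"
      unfolding weight_le_iff[of "E k"] using weight_nonneg weight_ge E_mono by blast
    then have "2 * real (H y n k) \<le> real (H y n (Suc k))"
      unfolding H_eq[of y n, symmetric] by (simp add: field_simps)
    then show ?thesis by linarith
  qed
  moreover have "(\<Sum>y\<in>W. H y n k) \<le> 2 ^ k" if "finite W" "antichain W" for n k W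
  proof -
    have "real (\<Sum>y\<in>W. H y n k) / 2 ^ k = (\<Sum>y\<in>W. weight (E k) y)"
      by (simp add: sum_divide_distrib H_eq)
    \<comment> \<open>The stage number \<open>k\<close> itself serves as a condition at which
      \<open>E k\<close> fits.\<close>
    also have "\<dots> \<le> (\<Sum>y\<in>W. max (a (string_of y) k) (weight (E k) y))"
      by (intro sum_mono) simp
    also have "\<dots> \<le> 1" using E_fits[of k] that unfolding fits_def by simp
    finally have "real (\<Sum>y\<in>W. H y n k) \<le> real (2 ^ k)" by (simp add: field_simps)
    then show ?thesis by linarith
  qed
  ultimately have "\<exists>b. cond_lsc_semimeasure halting_problem b \<and>
      (\<forall>x n k. real (H (node x) n k) / 2 ^ k \<le> b x n)"
    by (rule semimeasure_of_weights)
  then obtain b where b: "cond_lsc_semimeasure halting_problem b"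
    "\<And>x n k. real (H (node x) n k) / 2 ^ k \<le> b x n"
    by blast
  have "(1 / 2) ^ j \<le> b x 0" if "\<forall>\<^sub>F n in sequentially. (1 / 2) ^ j \<le> a x n" for x j
  proof -
    obtain N where N: "\<And>n. N \<le> n \<Longrightarrow> (1 / 2) ^ j \<le> a x n"
      using \<open>\<forall>\<^sub>F n in sequentially. (1 / 2) ^ j \<le> a x n\<close> unfolding eventually_sequentially by blast
    \<comment> \<open>Using \<open>N\<close> as the last component picks a repetition of the request
      for \<open>x\<close> and \<open>j\<close> at a stage no earlier than \<open>N\<close>.\<close>
    define s where "s = prod_encode (prod_encode (node x, j), N)"
    have s: "N \<le> s" "pi1 (pi1 s) = node x" "pi2 (pi1 s) = j"
      unfolding s_def by (simp_all add: le_prod_encode_2)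
    have "fits s (2 ^ s + E s)" unfolding fits_def
    proof (intro allI impI)
      fix n W assume n: "s \<le> n" and W: "finite W" "antichain W"
      \<comment> \<open>For \<open>n \<ge> s \<ge> N\<close> the new weight is already below
        \<open>a x n\<close>, so the request leaves the maxima unchanged.\<close>
      have "weight (2 ^ s + E s) y \<le> max (a (string_of y) n) (weight (E s) y)" for y
        unfolding weight_le_iff[of "2 ^ s + E s"] insert
        using weight_ge[of _ "E s"] weight_nonneg[of "E s" y] N[of n] n s
        by (auto simp: le_max_iff_disj)
      then have "(\<Sum>y\<in>W. max (a (string_of y) n) (weight (2 ^ s + E s) y))
          \<le> (\<Sum>y\<in>W. max (a (string_of y) n) (weight (E s) y))"
        by (intro sum_mono) simp
      also have "\<dots> \<le> 1" using E_fits[of s] n W unfolding fits_def by blast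
      finally show "(\<Sum>y\<in>W. max (a (string_of y) n) (weight (2 ^ s + E s) y)) \<le> 1" .
    qed
    moreover have "k \<le> s" if "k \<in> set_decode (2 ^ s + E s)" for k
      using that E_less[of k s] unfolding insert by auto
    ultimately have "grant (prod_encode (s, 2 ^ s + E s))"
      using grant_iff by blast
    then have "s \<in> set_decode (E (Suc s))" by (simp add: E_Suc insert)
    from weight_ge[OF this] have "(1 / 2) ^ j \<le> weight (E (Suc s)) (node x)" using s by simp
    also have "\<dots> \<le> b x 0" using b(2)[of x 0 "Suc s"] unfolding H_eq .
    finally show ?thesis .
  qed
  then show ?thesis using cond_lsc_semimeasure_instance[OF b(1)] that by blast
qed

section \<open>From semimeasures to complexities\<close>

text \<open>The weights \<open>2 ^ -(y + 1)\<close> have total at most \<open>1\<close> over all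
  nodes and generate a positive semimeasure, which \<open>m\<close> dominates. Hence the complexity
  is finite and can be subtracted.\<close>

lemma maximal_lsc_semimeasure_pos:
  assumes "maximal_lsc_semimeasure A m"
  shows "0 < m x"
proof -
  define H where "H y (n::nat) k = (if y < k then 2 ^ (k - Suc y) else 0 :: nat)" for y n k
  have "computable A (\<lambda>z. H (pi1 z) (pi1 (pi2 z)) (pi2 (pi2 z)))"
    unfolding H_def by (intro computable_intros)
  moreover have "2 * H y n k \<le> H y n (Suc k)" for y n k
    unfolding H_def by (simp add: Suc_diff_Suc flip: power_Suc)
  moreover have "(\<Sum>y\<in>W. H y n k) \<le> 2 ^ k" if "finite W" "antichain W" for n k W
  proof -
    have "(\<Sum>y\<in>W. H y n k) = (\<Sum>y\<in>W \<inter> {..<k}. 2 ^ (k - Suc y))"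
      unfolding H_def by (simp add: sum.inter_restrict[OF that(1)])
    also have "\<dots> \<le> (\<Sum>y<k. 2 ^ (k - Suc y))" by (intro sum_mono2) auto
    also have "\<dots> = (\<Sum>y<k. 2 ^ y)" by (rule sum.nat_diff_reindex)
    also have "\<dots> \<le> 2 ^ k" using sum_power2[of k] by (simp add: atLeast0LessThan)
    finally show ?thesis .
  qed
  ultimately have "\<exists>b. cond_lsc_semimeasure A b \<and>
      (\<forall>x n k. real (H (node x) n k) / 2 ^ k \<le> b x n)"
    by (rule semimeasure_of_weights)
  then obtain b where b: "cond_lsc_semimeasure A b"
    "\<And>x n k. real (H (node x) n k) / 2 ^ k \<le> b x n"
    by blast
  have "0 < real (H (node x) 0 (Suc (node x))) / 2 ^ Suc (node x)" by (simp add: H_def)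
  also have "\<dots> \<le> b x 0" by (rule b(2))
  finally have "0 < b x 0" .
  moreover obtain C where "0 < C" "b x 0 \<le> C * m x"
    using assms cond_lsc_semimeasure_instance[OF b(1), of 0] unfolding maximal_lsc_semimeasure_def by blast
  ultimately show ?thesis by (meson order_less_le_trans zero_less_mult_pos)
qed

theorem theorem5:
  fixes a :: "bool list \<Rightarrow> nat \<Rightarrow> real" and a0 :: "bool list \<Rightarrow> real"
  assumes "maximal_cond_lsc_semimeasure {} a"
    and "maximal_lsc_semimeasure halting_problem a0"
  shows "\<exists>c::real. \<forall>x::bool list.
    \<bar>limsup (\<lambda>n. KA_cond a x n) - KA a0 x\<bar> \<le> ereal c"
proof -
  have a: "cond_lsc_semimeasure {} a"
    and a_max: "\<And>b. cond_lsc_semimeasure {} b \<Longrightarrow> \<exists>C>0. \<forall>x n. b x n \<le> C * a x n"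
    using assms(1) unfolding maximal_cond_lsc_semimeasure_def by auto
  have a0: "lsc_semimeasure halting_problem a0"
    and a0_max: "\<And>b. lsc_semimeasure halting_problem b \<Longrightarrow> \<exists>C>0. \<forall>x. b x \<le> C * a0 x"
    using assms(2) unfolding maximal_lsc_semimeasure_def by auto
  obtain b1 where "cond_lsc_semimeasure {} b1"
    and b1: "\<And>x r. r < a0 x \<Longrightarrow> \<forall>\<^sub>F n in sequentially. r \<le> b1 x n"
    using liminf_dominates_halting_semimeasure[OF a0] by blast
  then obtain C1 where C1: "0 < C1" "\<And>x n. b1 x n \<le> C1 * a x n" using a_max by blast
  obtain b2 where "lsc_semimeasure halting_problem b2"
    and b2: "\<And>x j. \<forall>\<^sub>F n in sequentially. (1 / 2) ^ j \<le> a x n \<Longrightarrow> (1 / 2) ^ j \<le> b2 x"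
    using halting_semimeasure_dominates_liminf[OF a] by blast
  then obtain C2 where C2: "0 < C2" "\<And>x. b2 x \<le> C2 * a0 x" using a0_max by blast
  \<comment> \<open>The factor \<open>2\<close> comes from using \<open>p / 2\<close>, strictly
    below \<open>a0 x\<close>; the summand \<open>1\<close> comes from rounding the limit superior
    up to an integer.\<close>
  define c where "c = max (log 2 (2 * C1)) (1 + log 2 C2)"
  have "\<bar>limsup (\<lambda>n. KA_cond a x n) - KA a0 x\<bar> \<le> ereal c" for x
  proof -
    define p where "p = a0 x"
    have p: "0 < p" unfolding p_def using assms(2) by (rule maximal_lsc_semimeasure_pos)
    define L where "L = limsup (\<lambda>n. KA_cond a x n)"
    have "\<forall>\<^sub>F n in sequentially. p / 2 \<le> b1 x n" using p by (intro b1) (simp add: p_def)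
    then have "\<forall>\<^sub>F n in sequentially. KA_cond a x n \<le> ereal (- log 2 p + log 2 (2 * C1))"
    proof eventually_elim
      case (elim n)
      then have ge: "p / (2 * C1) \<le> a x n" using C1(1) C1(2)[of x n] by (simp add: field_simps)
      moreover have pos: "0 < p / (2 * C1)" using p C1(1) by simp
      ultimately have "0 < a x n" by linarith
      moreover have "log 2 (p / (2 * C1)) \<le> log 2 (a x n)" using ge pos by simp
      ultimately show ?case using p C1(1) unfolding KA_cond_def neg_log2_def by (simp add: log_divide)
    qed
    then have L_upper: "L \<le> ereal (- log 2 p + log 2 (2 * C1))"
      unfolding L_def by (rule Limsup_bounded)
    have "0 \<le> KA_cond a x n" for n
      using a unfolding KA_cond_def neg_log2_def cond_lsc_semimeasure_def semimeasure_def by simp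
    then have "0 \<le> L" unfolding L_def by (intro le_Limsup) auto
    \<comment> \<open>Finite on both sides, so the rest is real arithmetic.\<close>
    with L_upper obtain l where l: "L = ereal l" "0 \<le> l" by (cases L) auto
    \<comment> \<open>Strictly above \<open>l\<close>, as needed to pass from the limit superior to
      almost all \<open>n\<close>, yet at most \<open>l + 1\<close>.\<close>
    define j where "j = Suc (nat \<lfloor>l\<rfloor>)"
    have j: "l < real j" "real j \<le> l + 1" using l(2) unfolding j_def by linarith+
    have "\<forall>\<^sub>F n in sequentially. KA_cond a x n < ereal (real j)"
      using j(1) l(1) unfolding L_def by (intro Limsup_lessD) simp
    then have "\<forall>\<^sub>F n in sequentially. (1 / 2) ^ j \<le> a x n"
    proof eventually_elim
      case (elim n)
      then have pos: "0 < a x n" and "- log 2 (a x n) < real j"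
        unfolding KA_cond_def neg_log2_def by (auto split: if_splits)
      then have "2 powr (- real j) \<le> a x n" by (simp add: powr_le_iff)
      then show ?case by (simp add: powr_minus powr_realpow power_one_over inverse_eq_divide)
    qed
    then have "(1 / 2) ^ j \<le> C2 * p" using b2 C2(2)[of x] unfolding p_def by fastforce
    then have "log 2 ((1 / 2) ^ j) \<le> log 2 (C2 * p)" using C2(1) p by simp
    then have "- real j \<le> log 2 C2 + log 2 p"
      using C2(1) p by (simp add: log_mult log_nat_power log_divide)
    then have "\<bar>l - (- log 2 p)\<bar> \<le> c"
      using j(2) L_upper l(1) unfolding c_def by simp
    then show ?thesis
      using p unfolding L_def[symmetric] l(1) KA_def neg_log2_def p_def[symmetric] by simp
  qed
  then show ?thesis by blast
qed

end
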